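(* Let $\Phi_r$ be a time reparameterization of the flow $\Phi$ with associated function $r$. Assume that for every $x\in\mathcal{R}$ the Lyapunov exponents of $\Phi$ satisfy $$\lambda_1(x)\le\cdots\le\lambda_{j(x)-1}(x)<\lambda_{j(x)}(x)=0<\lambda_{j(x)+1}(x)\le\cdots\le\lambda_{\dim M}(x),$$ where $\lambda_{j(x)}(x)$ is the exponent associated to the flow direction $f(x)$. Then for every point $x\in\mathcal{R}\subset\widehat M$ that is Lyapunov regular with respect to both $\Phi$ and $\Phi_r$ and for which the limit $r_+(x)$ exists and satisfies $0<r_+(x)<\infty$, we have $$\lambda_i^r(x)\,r_+(x)=\lambda_i(x),\qquad i=1,\dots,\dim M,$$ and hence the number of positive, null, and negative Lyapunov exponents at $x$ is the same for $\Phi$ and $\Phi_r$.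
   Context: Setting. $M$ is a manifold of class $C^m$, $m\ge 2$, with a Riemannian metric of class $C^{m-1}$ and induced norm $\|\cdot\|$ on tangent spaces. $f$ is a $C^\ell$ vector field on $M$, $1\le \ell<m$, such that $dx/dt=f(x)$ generates a $C^\ell$ flow $\Phi=\{\varphi^t\}_{t\in\mathbb{R}}$. A $C^\ell$ flow $\Phi_r=\{\varphi^\tau_r\}_{\tau\in\mathbb{R}}$ on $M$ is a time reparameterization of $\Phi$ if for every $x$ the orbits of $x$ under both flows coincide and have the same orientation. Its associated function $r\ge0$ is positive and $C^{\ell-1}$ at every non-fixed point, where $\varphi_r^\tau(x)=\varphi^{t(x,\tau)}(x)$ and $r(x)=\big(\frac{\partial}{\partial\tau}t(x,\tau)|_{\tau=0}\big)^{-1}$. Thus $d\tau=r(x)\,dt$ and $\tau\mapsto\varphi_r^\tau(x)$ solves $dx/d\tau=f(x)/r(x)$. $\widehat M=\{x\in M:f(x)\ne0\}$, except that $\widehat M=M$ if $r$ is positive and $C^{\ell-1}$ on all of $M$. With $\tau(x,t)=\int_0^t r(\varphi^s(x))\,ds$ one has $\varphi_r^{\tau(x,t)}(x)=\varphi^t(x)$. Lyapunov exponents. For $v\in T_xM$, $\lambda^{+}(x,v)=\limsup_{t\to\infty}\frac1t\log\|D_x\varphi^{t}(v)\|$ and $\lambda^{-}(x,v)=\limsup_{t\to\infty}\frac1t\log\|D_x\varphi^{-t}(v)\|$. Lyapunov regularity of $x$ is understood in the standard (Oseledets, two-sided) sense. In particular, at a Lyapunov regular $x$ there is a unique splitting $T_xM=\bigoplus_{i=1}^{k(x)}E^i_x$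 with $D_x\varphi^t(E^i_x)=E^i_{\varphi^t(x)}$, and there are distinct numbers (one for each $i$, increasing in $i$) equal to $\lim_{t\to\pm\infty}\frac1t\log\|D_x\varphi^t(v)\|=\lambda^+(x,v)=-\lambda^-(x,v)$ for all $v\in E^i_x\setminus\{0\}$. Moreover $\lim_{t\to\pm\infty}\frac1t\log|\sin\angle(D_x\varphi^t(v),D_x\varphi^t(w))|=0$ for nonzero $v\in E_x^i$, $w\in E_x^j$, $i\ne j$. Counted with multiplicity $\dim E^i_x$, these numbers are the Lyapunov exponents $\lambda_1(x)\le\cdots\le\lambda_{\dim M}(x)$ of $\Phi$ at $x$. The exponents of $\Phi_r$ at a point that is Lyapunov regular for $\Phi_r$, defined in the same way with $\varphi_r^\tau$, are denoted $\lambda_1^r(x)\le\cdots\le\lambda^r_{\dim M}(x)$. $\mathcal R\subset\widehat M$ is the set of points that are Lyapunov regular for $\Phi$ and for which there is an index $j(x)$ such that the corresponding subspace $E_x^{j(x)}$ is one-dimensional and $\lambda_{j(x)}(x)$ is the exponent in the direction of $f(x)$ (i.e. $E^{j(x)}_x$ is the flow direction). $r_+(x)=\lim_{t\to\infty}\frac1t\int_0^t r(\varphi^s(x))\,ds$ whenever this limit exists. *)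

theory Defs
  imports "HOL-Analysis.Analysis"
begin

section \<open>Maps of class \<open>C\<^sup>k\<close>\<close>

text \<open>Class \<open>C\<^sup>k\<close> on a set \<open>S\<close> of a Euclidean space; it is meant, and below only used, for open \<open>S\<close>.\<close>

fun Ck_on :: "nat \<Rightarrow> ('a::euclidean_space \<Rightarrow> 'b::real_normed_vector) \<Rightarrow> 'a set \<Rightarrow> bool" where
  "Ck_on 0 F S \<longleftrightarrow> continuous_on S F"
| "Ck_on (Suc k) F S \<longleftrightarrow>
     (\<forall>x\<in>S. F differentiable (at x)) \<and> (\<forall>v. Ck_on k (\<lambda>x. frechet_derivative F (at x) v) S)"


section \<open>Manifolds and tangent spaces\<close>

text \<open>A chart is a pair of its domain \<open>U\<close> and its coordinate map, which matters only on \<open>U\<close>.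
  The manifold is the whole type \<open>'a\<close>; the sort constraint \<open>{t2_space, second_countable_topology}\<close>
  is imposed in the theorem. The atlas need not be maximal.\<close>

type_synonym ('a, 'n) chart = "'a set \<times> ('a \<Rightarrow> real ^ 'n)"

definition chart_inv :: "('a, 'n::finite) chart \<Rightarrow> real ^ 'n \<Rightarrow> 'a" where
  "chart_inv C = inv_into (fst C) (snd C)"

definition is_chart :: "('a::topological_space, 'n::finite) chart \<Rightarrow> bool" where
  "is_chart C \<longleftrightarrow> open (fst C) \<and> open (snd C ` fst C) \<and>
     homeomorphism (fst C) (snd C ` fst C) (snd C) (chart_inv C)"

definition Ck_manifold :: "nat \<Rightarrow> ('a::topological_space, 'n::finite) chart set \<Rightarrow> bool" where
  "Ck_manifold m A \<longleftrightarrow> (\<forall>C\<in>A. is_chart C) \<and> (\<Union>C\<in>A. fst C) = UNIV \<and>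
     (\<forall>C\<in>A. \<forall>D\<in>A. Ck_on m (snd D \<circ> chart_inv C) (snd C ` (fst C \<inter> fst D)))"

text \<open>The tangent space at \<open>x\<close> is represented by \<open>real ^ 'n\<close>, through the coordinates of one chosen
  chart \<open>chart_at A x\<close> around \<open>x\<close>. Vector fields and metrics are functions of the base point
  with values expressed in these coordinates. Since the chosen chart need not vary continuously with
  \<open>x\<close>, their regularity is always tested after a change to the coordinates of a fixed chart \<open>C\<close>
  (\<open>to_chart\<close>, \<open>from_chart\<close>).\<close>

definition chart_at :: "('a, 'n::finite) chart set \<Rightarrow> 'a \<Rightarrow> ('a, 'n) chart" where
  "chart_at A x = (SOME C. C \<in> A \<and> x \<in> fst C)"

definition to_chart :: "('a, 'n::finite) chart set \<Rightarrow> ('a, 'n) chart \<Rightarrow> 'a \<Rightarrow> real ^ 'n \<Rightarrow> real ^ 'n" where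
  "to_chart A C x v =
     frechet_derivative (snd C \<circ> chart_inv (chart_at A x)) (at (snd (chart_at A x) x)) v"

definition from_chart :: "('a, 'n::finite) chart set \<Rightarrow> ('a, 'n) chart \<Rightarrow> 'a \<Rightarrow> real ^ 'n \<Rightarrow> real ^ 'n" where
  "from_chart A C x v =
     frechet_derivative (snd (chart_at A x) \<circ> chart_inv C) (at (snd C x)) v"

definition tangent_map :: "('a, 'n::finite) chart set \<Rightarrow> ('a \<Rightarrow> 'a) \<Rightarrow> 'a \<Rightarrow> real ^ 'n \<Rightarrow> real ^ 'n" where
  "tangent_map A F x v =
     frechet_derivative (snd (chart_at A (F x)) \<circ> F \<circ> chart_inv (chart_at A x))
       (at (snd (chart_at A x) x)) v"

definition Ck_function :: "('a, 'n::finite) chart set \<Rightarrow> nat \<Rightarrow> ('a \<Rightarrow> real) \<Rightarrow> 'a set \<Rightarrow> bool" where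
  "Ck_function A k h S \<longleftrightarrow> (\<forall>C\<in>A. Ck_on k (h \<circ> chart_inv C) (snd C ` (fst C \<inter> S)))"

definition Ck_vector_field :: "('a, 'n::finite) chart set \<Rightarrow> nat \<Rightarrow> ('a \<Rightarrow> real ^ 'n) \<Rightarrow> bool" where
  "Ck_vector_field A k f \<longleftrightarrow>
     (\<forall>C\<in>A. Ck_on k (\<lambda>y. to_chart A C (chart_inv C y) (f (chart_inv C y))) (snd C ` fst C))"

definition Ck_riemannian_metric ::
  "('a, 'n::finite) chart set \<Rightarrow> nat \<Rightarrow> ('a \<Rightarrow> real ^ 'n \<Rightarrow> real ^ 'n \<Rightarrow> real) \<Rightarrow> bool" where
  "Ck_riemannian_metric A k g \<longleftrightarrow>
     (\<forall>x. bilinear (g x) \<and> (\<forall>u v. g x u v = g x v u) \<and> (\<forall>v. v \<noteq> 0 \<longrightarrow> 0 < g x v v)) \<and>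
     (\<forall>C\<in>A. \<forall>u v. Ck_on k
        (\<lambda>y. g (chart_inv C y) (from_chart A C (chart_inv C y) u) (from_chart A C (chart_inv C y) v))
        (snd C ` fst C))"

definition tnorm :: "('a \<Rightarrow> real ^ 'n \<Rightarrow> real ^ 'n \<Rightarrow> real) \<Rightarrow> 'a \<Rightarrow> real ^ 'n \<Rightarrow> real" where
  "tnorm g x v = sqrt (g x v v)"

definition tangle :: "('a \<Rightarrow> real ^ 'n \<Rightarrow> real ^ 'n \<Rightarrow> real) \<Rightarrow> 'a \<Rightarrow> real ^ 'n \<Rightarrow> real ^ 'n \<Rightarrow> real" where
  "tangle g x u v = arccos (g x u v / (tnorm g x u * tnorm g x v))"

text \<open>The absolute value of the determinant of the tangent map with respect to orthonormal bases of
  the tangent spaces at \<open>x\<close> and \<open>F x\<close>, computed as a quotient of Gram determinants.\<close>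

definition jacobian ::
  "('a, 'n::finite) chart set \<Rightarrow> ('a \<Rightarrow> real ^ 'n \<Rightarrow> real ^ 'n \<Rightarrow> real) \<Rightarrow> ('a \<Rightarrow> 'a) \<Rightarrow> 'a \<Rightarrow> real" where
  "jacobian A g F x =
     sqrt (det (\<chi> i j. g (F x) (tangent_map A F x (axis i 1)) (tangent_map A F x (axis j 1)))
           / det (\<chi> i j. g x (axis i 1) (axis j 1)))"


section \<open>Flows and time reparameterizations\<close>

definition Ck_flow ::
  "('a::topological_space, 'n::finite) chart set \<Rightarrow> nat \<Rightarrow> (real \<Rightarrow> 'a \<Rightarrow> 'a) \<Rightarrow> bool" where
  "Ck_flow A k \<phi> \<longleftrightarrow>
     (\<forall>x. \<phi> 0 x = x) \<and> (\<forall>s t x. \<phi> (s + t) x = \<phi> s (\<phi> t x)) \<and>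
     continuous_on UNIV (\<lambda>(t, x). \<phi> t x) \<and>
     (\<forall>C\<in>A. \<forall>D\<in>A. Ck_on k (\<lambda>(t, y). snd D (\<phi> t (chart_inv C y)))
        {(t, y). y \<in> snd C ` fst C \<and> \<phi> t (chart_inv C y) \<in> fst D})"

definition generates :: "('a, 'n::finite) chart set \<Rightarrow> ('a \<Rightarrow> real ^ 'n) \<Rightarrow> (real \<Rightarrow> 'a \<Rightarrow> 'a) \<Rightarrow> bool" where
  "generates A f \<phi> \<longleftrightarrow>
     (\<forall>t x. ((\<lambda>s. snd (chart_at A (\<phi> t x)) (\<phi> s x)) has_vector_derivative f (\<phi> t x)) (at t))"

text \<open>The orbits of \<open>x\<close> under \<open>\<phi>\<close> and \<open>\<psi>\<close> coincide, with the same orientation, through the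
  increasing bijection \<open>T x\<close> of the time axis (an increasing bijection of the reals is continuous).
  Off the fixed points of \<open>\<phi>\<close> it is the only continuous one with \<open>T x 0 = 0\<close>.\<close>

definition orbit_time_change ::
  "(real \<Rightarrow> 'a \<Rightarrow> 'a) \<Rightarrow> (real \<Rightarrow> 'a \<Rightarrow> 'a) \<Rightarrow> ('a \<Rightarrow> real \<Rightarrow> real) \<Rightarrow> bool" where
  "orbit_time_change \<phi> \<psi> T \<longleftrightarrow>
     (\<forall>x. T x 0 = 0 \<and> strict_mono (T x) \<and> surj (T x) \<and> (\<forall>\<tau>. \<psi> \<tau> x = \<phi> (T x \<tau>) x))"

text \<open>\<open>\<psi>\<close> is a time reparameterization of \<open>\<phi>\<close>, which is generated by \<open>f\<close>, with associated function
  \<open>r\<close>. At fixed points \<open>r\<close> is not determined by \<open>\<phi>\<close> and \<open>\<psi>\<close>.\<close>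

definition time_reparameterization ::
  "('a::topological_space, 'n::finite) chart set \<Rightarrow> nat \<Rightarrow> ('a \<Rightarrow> real ^ 'n) \<Rightarrow>
   (real \<Rightarrow> 'a \<Rightarrow> 'a) \<Rightarrow> (real \<Rightarrow> 'a \<Rightarrow> 'a) \<Rightarrow> ('a \<Rightarrow> real) \<Rightarrow> bool" where
  "time_reparameterization A l f \<phi> \<psi> r \<longleftrightarrow>
     Ck_flow A l \<psi> \<and>
     (\<exists>T. orbit_time_change \<phi> \<psi> T \<and>
          (\<forall>x. f x \<noteq> 0 \<longrightarrow> (T x has_real_derivative inverse (r x)) (at 0))) \<and>
     (\<forall>x. 0 \<le> r x) \<and> (\<forall>x. f x \<noteq> 0 \<longrightarrow> 0 < r x) \<and> Ck_function A (l - 1) r {x. f x \<noteq> 0}"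

definition Mhat :: "('a, 'n::finite) chart set \<Rightarrow> nat \<Rightarrow> ('a \<Rightarrow> real ^ 'n) \<Rightarrow> ('a \<Rightarrow> real) \<Rightarrow> 'a set" where
  "Mhat A l f r =
     (if (\<forall>x. 0 < r x) \<and> Ck_function A (l - 1) r UNIV then UNIV else {x. f x \<noteq> 0})"

definition orbit_average :: "(real \<Rightarrow> 'a \<Rightarrow> 'a) \<Rightarrow> ('a \<Rightarrow> real) \<Rightarrow> 'a \<Rightarrow> real \<Rightarrow> real" where
  "orbit_average \<phi> r x t = 1 / t * integral {0..t} (\<lambda>s. r (\<phi> s x))"


section \<open>Lyapunov regularity and Lyapunov exponents\<close>

definition tendsto_both_ends :: "(real \<Rightarrow> real) \<Rightarrow> real \<Rightarrow> bool" where
  "tendsto_both_ends h c \<longleftrightarrow> (h \<longlongrightarrow> c) at_top \<and> (h \<longlongrightarrow> c) at_bot"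

text \<open>The vectors at \<open>x\<close> with two-sided exponent \<open>c\<close>. If an Oseledets splitting at \<open>x\<close> exists, it is
  unique: its summands are exactly the nonzero sets \<open>lyap_space A g \<phi> x c\<close>.\<close>

definition lyap_space ::
  "('a, 'n::finite) chart set \<Rightarrow> ('a \<Rightarrow> real ^ 'n \<Rightarrow> real ^ 'n \<Rightarrow> real) \<Rightarrow> (real \<Rightarrow> 'a \<Rightarrow> 'a) \<Rightarrow>
   'a \<Rightarrow> real \<Rightarrow> (real ^ 'n) set" where
  "lyap_space A g \<phi> x c =
     {v. v = 0 \<or> tendsto_both_ends (\<lambda>t. 1 / t * ln (tnorm g (\<phi> t x) (tangent_map A (\<phi> t) x v))) c}"

definition lyap_values ::
  "('a, 'n::finite) chart set \<Rightarrow> ('a \<Rightarrow> real ^ 'n \<Rightarrow> real ^ 'n \<Rightarrow> real) \<Rightarrow> (real \<Rightarrow> 'a \<Rightarrow> 'a) \<Rightarrow>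
   'a \<Rightarrow> real set" where
  "lyap_values A g \<phi> x = {c. lyap_space A g \<phi> x c \<noteq> {0}}"

text \<open>Two-sided regularity: the tangent space is the direct sum of the finitely many spaces
  \<open>lyap_space A g \<phi> x c\<close>, and the volume growth rate is the sum of the exponents counted with
  multiplicity. The clause on angles follows from the one on volumes and is listed for convenience;
  invariance of the splitting along the orbit also follows, by its uniqueness.\<close>

definition lyap_regular ::
  "('a, 'n::finite) chart set \<Rightarrow> ('a \<Rightarrow> real ^ 'n \<Rightarrow> real ^ 'n \<Rightarrow> real) \<Rightarrow> (real \<Rightarrow> 'a \<Rightarrow> 'a) \<Rightarrow>
   'a \<Rightarrow> bool" where
  "lyap_regular A g \<phi> x \<longleftrightarrow>
     finite (lyap_values A g \<phi> x) \<and>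
     (\<forall>c. c \<in> lyap_values A g \<phi> x \<longrightarrow> subspace (lyap_space A g \<phi> x c)) \<and>
     (\<forall>v. \<exists>!w. w \<in> (\<Pi>\<^sub>E c\<in>lyap_values A g \<phi> x. lyap_space A g \<phi> x c) \<and>
               v = (\<Sum>c\<in>lyap_values A g \<phi> x. w c)) \<and>
     tendsto_both_ends (\<lambda>t. 1 / t * ln (jacobian A g (\<phi> t) x))
       (\<Sum>c\<in>lyap_values A g \<phi> x. real (dim (lyap_space A g \<phi> x c)) * c) \<and>
     (\<forall>c\<in>lyap_values A g \<phi> x. \<forall>d\<in>lyap_values A g \<phi> x. c \<noteq> d \<longrightarrow>
        (\<forall>v\<in>lyap_space A g \<phi> x c - {0}. \<forall>w\<in>lyap_space A g \<phi> x d - {0}.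
           tendsto_both_ends
             (\<lambda>t. 1 / t * ln \<bar>sin (tangle g (\<phi> t x) (tangent_map A (\<phi> t) x v)
                                                  (tangent_map A (\<phi> t) x w))\<bar>) 0))"

text \<open>The exponents \<open>\<lambda>\<^sub>1 \<le> \<dots> \<le> \<lambda>\<^sub>n\<close> counted with multiplicity, for \<open>i \<in> {1..CARD('n)}\<close>; meaningful
  at regular points.\<close>

definition lyap_exponent ::
  "('a, 'n::finite) chart set \<Rightarrow> ('a \<Rightarrow> real ^ 'n \<Rightarrow> real ^ 'n \<Rightarrow> real) \<Rightarrow> (real \<Rightarrow> 'a \<Rightarrow> 'a) \<Rightarrow>
   'a \<Rightarrow> nat \<Rightarrow> real" where
  "lyap_exponent A g \<phi> x i =
     concat (map (\<lambda>c. replicate (dim (lyap_space A g \<phi> x c)) c)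
                 (sorted_list_of_set (lyap_values A g \<phi> x))) ! (i - 1)"

text \<open>\<open>j\<close> is the position, in the list of exponents counted with multiplicity, of the exponent of a
  one-dimensional summand of the splitting that is spanned by \<open>f x\<close>.\<close>

definition flow_direction_index ::
  "('a, 'n::finite) chart set \<Rightarrow> ('a \<Rightarrow> real ^ 'n \<Rightarrow> real ^ 'n \<Rightarrow> real) \<Rightarrow> ('a \<Rightarrow> real ^ 'n) \<Rightarrow>
   (real \<Rightarrow> 'a \<Rightarrow> 'a) \<Rightarrow> 'a \<Rightarrow> nat \<Rightarrow> bool" where
  "flow_direction_index A g f \<phi> x j \<longleftrightarrow>
     j \<in> {1..CARD('n)} \<and>
     dim (lyap_space A g \<phi> x (lyap_exponent A g \<phi> x j)) = 1 \<and>
     lyap_space A g \<phi> x (lyap_exponent A g \<phi> x j) = span {f x}"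

definition R_set ::
  "('a, 'n::finite) chart set \<Rightarrow> ('a \<Rightarrow> real ^ 'n \<Rightarrow> real ^ 'n \<Rightarrow> real) \<Rightarrow> nat \<Rightarrow> ('a \<Rightarrow> real ^ 'n) \<Rightarrow>
   (real \<Rightarrow> 'a \<Rightarrow> 'a) \<Rightarrow> ('a \<Rightarrow> real) \<Rightarrow> 'a set" where
  "R_set A g l f \<phi> r =
     {x \<in> Mhat A l f r. lyap_regular A g \<phi> x \<and> (\<exists>j. flow_direction_index A g f \<phi> x j)}"

end

theory Submission
  imports Defs
begin

text \<open>A point \<open>x\<close> moves along the same orbit under both flows: \<open>\<psi> \<tau> x = \<phi> (T x \<tau>) x\<close>. Differentiating in \<open>x\<close>,
the time \<open>T x \<tau>\<close> contributes only a multiple of the velocity, so \<open>D\<psi>\<^sup>\<tau>\<close> and \<open>D\<phi>\<^bsup>T x \<tau>\<^esup>\<close> agree modulo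
\<open>f (\<psi> \<tau> x)\<close> (\<open>repar_tangent_map_diff\<close>), while \<open>f x\<close> itself is carried to
\<open>(r x / r (\<psi> \<tau> x)) f (\<psi> \<tau> x)\<close> (\<open>repar_tangent_map_field\<close>). The inverse of \<open>T x\<close> is \<open>\<integral> r (\<phi> s x) ds\<close>,
hence \<open>\<tau> / T x \<tau>\<close> tends to \<open>r_plus\<close>, and a rate \<open>c\<close> per unit of \<open>t\<close> is a rate \<open>c / r_plus\<close> per unit
of \<open>\<tau>\<close> (\<open>time_changed_rate\<close>). As \<open>r_plus\<close> describes the future of \<open>x\<close>, all rates below are forward rates.

Volumes. In a frame containing the flow direction, \<open>D\<psi>\<^sup>\<tau>\<close> arises from \<open>D\<phi>\<^bsup>T x \<tau>\<^esup>\<close> by a shear and one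
rescaling, so the Jacobians have the quotient \<open>r x / r (\<psi> \<tau> x)\<close>. Both Jacobians have exponential
rates because \<open>x\<close> is regular for both flows. Hence \<open>r\<close> has an exponential rate along the orbit, and this rate must
be \<open>0\<close>, for otherwise the averages of \<open>r\<close> would tend to infinity or to zero
(\<open>exponential_rate_of_speed_zero\<close>). Two consequences (\<open>repar_volume\<close>, \<open>repar_exponent_flow_direction\<close>): the
sum of the exponents of \<open>\<psi>\<close>, times \<open>r_plus\<close>, is the sum of the exponents of \<open>\<phi>\<close>; and the flow direction still
has exponent \<open>0\<close> for \<open>\<psi>\<close>.

Lower bound. Let \<open>e\<^sub>1, \<dots>, e\<^sub>n\<close> be a basis adapted to the splitting for \<open>\<phi>\<close>, with \<open>e\<^sub>j\<close> in the flow
direction, and let \<open>v\<close> have a nonzero coefficient \<open>a\<^sub>k\<close> with \<open>k \<noteq> j\<close>. Replacing \<open>D\<phi> e\<^sub>k\<close> by \<open>D\<psi> v\<close> in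
the frame \<open>D\<phi> e\<^sub>1, \<dots>, D\<phi> e\<^sub>n\<close> multiplies its volume by \<open>\<bar>a\<^sub>k\<bar>\<close>, since multiples of \<open>D\<phi> e\<^sub>j\<close> do not
count. A volume is bounded by a constant times the product of the lengths, and regularity says that
the volume grows at the rate of the product of all \<open>\<parallel>D\<phi> e\<^sub>i\<parallel>\<close>; so \<open>\<parallel>D\<psi> v\<parallel>\<close> must grow
at least as fast as \<open>\<parallel>D\<phi> e\<^sub>k\<parallel>\<close> (\<open>repar_exponent_lower_bound\<close>).

Counting. Suppose the \<open>i\<close>-th exponent of \<open>\<psi>\<close>, times \<open>r_plus\<close>, were smaller than that of \<open>\<phi>\<close>. By the
lower bound, the first \<open>i\<close> vectors of a basis adapted to \<open>\<psi>\<close> lie in the span of \<open>e\<^sub>j\<close> and the \<open>e\<^sub>k\<close> with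
\<open>k < i\<close>. If \<open>j < i\<close>, this span is too small. If \<open>j \<ge> i\<close>, they fill it, so \<open>f x\<close> is a
combination of vectors with negative exponents, although its own exponent is \<open>0\<close>. Hence every
exponent of \<open>\<psi>\<close>, times \<open>r_plus\<close>, is at least that of \<open>\<phi>\<close>, and equality of the sums makes all of them equal.\<close>

section \<open>Gram determinants of frames\<close>

definition gram :: "(real ^ 'n \<Rightarrow> real ^ 'n \<Rightarrow> real) \<Rightarrow> ('n::finite \<Rightarrow> real ^ 'n) \<Rightarrow> real" where
  "gram G v = det (\<chi> i j. G (v i) (v j))"

definition inner_form :: "(real ^ 'n \<Rightarrow> real ^ 'n \<Rightarrow> real) \<Rightarrow> bool" where
  "inner_form G \<longleftrightarrow> bilinear G \<and> (\<forall>u v. G u v = G v u) \<and> (\<forall>v. v \<noteq> 0 \<longrightarrow> 0 < G v v)"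

lemma bilinear_axis_expansion:
  fixes G :: "real ^ 'n::finite \<Rightarrow> real ^ 'n \<Rightarrow> real"
  assumes "bilinear G"
  shows "G u v = (\<Sum>k\<in>UNIV. \<Sum>l\<in>UNIV. u $ k * G (axis k 1) (axis l 1) * v $ l)"
proof -
  have l1: "linear (\<lambda>a. G a v)" for v using assms unfolding bilinear_def by auto
  have l2: "linear (G u)" for u using assms unfolding bilinear_def by auto
  have G1: "G a b = (\<Sum>k\<in>UNIV. a $ k * G (axis k 1) b)" for a b
    using linear_sum[OF l1, of "\<lambda>k. a $ k *\<^sub>R axis k 1" UNIV b]
    by (simp add: linear_cmul[OF l1] basis_expansion[of a, unfolded scalar_mult_eq_scaleR])
  have G2: "G a b = (\<Sum>l\<in>UNIV. b $ l * G a (axis l 1))" for a b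
    using linear_sum[OF l2, of a "\<lambda>l. b $ l *\<^sub>R axis l 1" UNIV]
    by (simp add: linear_cmul[OF l2] basis_expansion[of b, unfolded scalar_mult_eq_scaleR])
  show ?thesis
    unfolding G1[of u v] G2[of "axis _ 1" v] by (simp add: sum_distrib_left mult_ac)
qed

text \<open>The quotient of the Gram determinants of two frames does not depend on the form. Growth of volumes thus
reduces to row operations on ordinary determinants.\<close>

lemma gram_eq_det_squared:
  fixes G :: "real ^ 'n::finite \<Rightarrow> real ^ 'n \<Rightarrow> real"
  assumes "bilinear G"
  shows "gram G v = gram G (\<lambda>i. axis i 1) * (det (\<chi> i. v i))\<^sup>2"
proof -
  define V where "V = (\<chi> i. v i)"
  define K where "K = (\<chi> i j. G (axis i 1) (axis j 1))"
  have "(\<chi> i j. G (v i) (v j)) = V ** K ** transpose V"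
    unfolding vec_eq_iff
    by (auto simp: V_def K_def matrix_matrix_mult_def transpose_def sum_distrib_left sum_distrib_right
       bilinear_axis_expansion[OF assms, of "v _" "v _"] intro: sum.swap)
  then show ?thesis unfolding gram_def
    by (simp add: det_mul det_transpose power2_eq_square flip: V_def K_def)
qed

lemma inner_form_simps:
  assumes "inner_form G"
  shows "bilinear G" "G u v = G v u" "v \<noteq> 0 \<Longrightarrow> 0 < G v v" "G 0 v = 0" "G u 0 = 0" "0 \<le> G v v"
proof -
  show b: "bilinear G" and s: "G u v = G v u" and p: "v \<noteq> 0 \<Longrightarrow> 0 < G v v"
    using assms unfolding inner_form_def by auto
  show "G 0 v = 0" "G u 0 = 0" using b by (simp_all add: bilinear_lzero bilinear_rzero)
  then show "0 \<le> G v v" using p by (cases "v = 0") (auto simp: less_imp_le bilinear_lzero[OF b])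
qed

text \<open>The Gram matrix is joined to the identity by a segment of positive definite matrices, along which the
determinant cannot vanish.\<close>

lemma gram_axis_pos:
  fixes G :: "real ^ 'n::finite \<Rightarrow> real ^ 'n \<Rightarrow> real"
  assumes "inner_form G"
  shows "0 < gram G (\<lambda>i. axis i 1)"
proof (rule ccontr)
  assume neg: "\<not> 0 < gram G (\<lambda>i. axis i 1)"
  define B :: "real \<Rightarrow> real ^ 'n \<Rightarrow> real ^ 'n \<Rightarrow> real" where
    "B s u v = (1 - s) * (u \<bullet> v) + s * G u v" for s u v
  define K :: "real \<Rightarrow> real ^ 'n ^ 'n" where "K s = (\<chi> i j. B s (axis i 1) (axis j 1))" for s
  have b: "bilinear G" using inner_form_simps[OF assms] by blast
  have bB: "bilinear (B s)" for s
  proof -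
    have "linear (B s u)" for u
      by (rule linearI) (simp_all add: B_def inner_simps bilinear_radd[OF b] bilinear_rmul[OF b] algebra_simps)
    moreover have "linear (\<lambda>u. B s u v)" for v
      by (rule linearI) (simp_all add: B_def inner_simps bilinear_ladd[OF b] bilinear_lmul[OF b] algebra_simps)
    ultimately show ?thesis unfolding bilinear_def by blast
  qed
  have K_axis: "K s $ i $ j = B s (axis i 1) (axis j 1)" for s i j by (simp add: K_def)
  have cont: "continuous_on {0..1} (\<lambda>s. det (K s))"
    unfolding det_def K_def B_def by (auto intro!: continuous_intros)
  have K0: "K 0 = mat 1" by (simp add: K_def B_def mat_def vec_eq_iff inner_axis_axis)
  have K1: "det (K 1) = gram G (\<lambda>i. axis i 1)" by (simp add: K_def B_def gram_def)
  obtain s where s: "0 \<le> s" "s \<le> 1" "det (K s) = 0"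
    using IVT2'[of "\<lambda>s. det (K s)" 1 0 0] neg K1 K0 cont by auto
  then obtain v where v: "v \<noteq> 0" "K s *v v = 0"
    using invertible_det_nz[of "K s"] by (metis matrix_left_invertible_ker invertible_left_inverse)
  have "v \<bullet> (K s *v v) = B s v v"
    unfolding bilinear_axis_expansion[OF bB, of s v v]
    by (simp add: inner_vec_def matrix_vector_mult_def K_axis sum_distrib_left mult_ac)
  moreover have "(1 - s) * (v \<bullet> v) + s * G v v > 0"
  proof (cases "s = 1")
    case True then show ?thesis using inner_form_simps(3)[OF assms v(1)] by simp
  next
    case False
    then have "(1 - s) * (v \<bullet> v) > 0" using s v by simp
    moreover have "s * G v v \<ge> 0" using s inner_form_simps(6)[OF assms] by simp
    ultimately show ?thesis by linarith
  qed
  ultimately show False using v unfolding B_def by simp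
qed

lemma inner_form_Cauchy_Schwarz:
  assumes "inner_form G"
  shows "\<bar>G u v\<bar> \<le> sqrt (G u u) * sqrt (G v v)"
proof (cases "v = 0")
  case True
  then show ?thesis using inner_form_simps(5)[OF assms] by simp
next
  case False
  note i = inner_form_simps[OF assms]
  define w where "w = G v v *\<^sub>R u - G u v *\<^sub>R v"
  have vp: "0 < G v v" using i False by blast
  have "0 \<le> G w w" using i by blast
  also have "G w w = G v v * (G v v * G u u - (G u v)\<^sup>2)"
    unfolding w_def using i(2)[of v u]
    by (simp add: bilinear_lsub[OF i(1)] bilinear_rsub[OF i(1)] bilinear_lmul[OF i(1)] bilinear_rmul[OF i(1)]
       power2_eq_square algebra_simps)
  finally have "(G u v)\<^sup>2 \<le> G u u * G v v" using vp by (simp add: zero_le_mult_iff mult.commute)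
  then have "sqrt ((G u v)\<^sup>2) \<le> sqrt (G u u * G v v)" by (rule real_sqrt_le_mono)
  then show ?thesis by (simp add: real_sqrt_mult)
qed

lemma inner_form_triangle:
  assumes "inner_form G"
  shows "sqrt (G (u + v) (u + v)) \<le> sqrt (G u u) + sqrt (G v v)"
proof -
  note i = inner_form_simps[OF assms]
  have "G (u + v) (u + v) = G u u + 2 * G u v + G v v"
    using i(2)[of v u] by (simp add: bilinear_ladd[OF i(1)] bilinear_radd[OF i(1)])
  also have "\<dots> \<le> (sqrt (G u u) + sqrt (G v v))\<^sup>2"
    using inner_form_Cauchy_Schwarz[OF assms, of u v] i(6) by (simp add: power2_sum)
  finally show ?thesis using i(6) by (intro real_le_lsqrt) auto
qed

text \<open>A weak form of Hadamard's inequality. Each term of the Leibniz expansion is bounded by Cauchy-Schwarz; the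
factor \<open>n!\<close> is harmless since only exponential rates matter.\<close>

lemma gram_le_fact_prod:
  fixes G :: "real ^ 'n::finite \<Rightarrow> real ^ 'n \<Rightarrow> real"
  assumes "inner_form G"
  shows "gram G v \<le> fact CARD('n) * (\<Prod>i\<in>UNIV. G (v i) (v i))"
proof -
  note i = inner_form_simps[OF assms]
  have "of_int (sign p) * (\<Prod>i\<in>UNIV. G (v i) (v (p i))) \<le> (\<Prod>i\<in>UNIV. G (v i) (v i))"
    if p: "p permutes (UNIV :: 'n set)" for p
  proof -
    have "of_int (sign p) * (\<Prod>i\<in>UNIV. G (v i) (v (p i))) \<le> \<bar>\<Prod>i\<in>UNIV. G (v i) (v (p i))\<bar>"
      by (auto simp: sign_def)
    also have "\<dots> \<le> (\<Prod>i\<in>UNIV. sqrt (G (v i) (v i)) * sqrt (G (v (p i)) (v (p i))))"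
      unfolding abs_prod by (intro prod_mono) (auto intro: inner_form_Cauchy_Schwarz[OF assms])
    also have "\<dots> = (\<Prod>i\<in>UNIV. sqrt (G (v i) (v i))) * (\<Prod>i\<in>UNIV. sqrt (G (v (p i)) (v (p i))))"
      by (rule prod.distrib)
    also have "(\<Prod>i\<in>UNIV. sqrt (G (v (p i)) (v (p i)))) = (\<Prod>i\<in>UNIV. sqrt (G (v i) (v i)))"
      using prod.permute[OF p, of "\<lambda>i. sqrt (G (v i) (v i))"] by (simp add: o_def)
    also have "(\<Prod>i\<in>UNIV. sqrt (G (v i) (v i))) * (\<Prod>i\<in>UNIV. sqrt (G (v i) (v i))) = (\<Prod>i\<in>UNIV. G (v i) (v i))"
      using i(6) by (simp flip: prod.distrib)
    finally show ?thesis .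
  qed
  then have "gram G v \<le> (\<Sum>p | p permutes (UNIV :: 'n set). \<Prod>i\<in>UNIV. G (v i) (v i))"
    unfolding gram_def det_def by (intro sum_mono) auto
  then show ?thesis by (simp add: card_permutations[OF refl])
qed

lemma det_add_multiples_of_row:
  fixes w :: "'n::finite \<Rightarrow> real ^ 'n"
  assumes "finite S" "j \<notin> S"
  shows "det (\<chi> i. if i \<in> S then w i + a i *\<^sub>R w j else w i) = det (\<chi> i. w i)"
  using assms
proof (induction S rule: finite_induct)
  case empty then show ?case by simp
next
  case (insert s S)
  define B where "B = (\<chi> i. if i \<in> S then w i + a i *\<^sub>R w j else w i)"
  have "(\<chi> i. if i \<in> insert s S then w i + a i *\<^sub>R w j else w i)
      = (\<chi> k. if k = s then row s B + a s *s row j B else row k B)"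
    using insert by (auto simp: B_def row_def vec_eq_iff)
  then have "det (\<chi> i. if i \<in> insert s S then w i + a i *\<^sub>R w j else w i) = det B"
    using insert det_row_operation[of s j B "a s"] by auto
  then show ?case using insert B_def by simp
qed

lemma det_replace_row:
  fixes w :: "'n::finite \<Rightarrow> real ^ 'n"
  shows "det (\<chi> i. if i = k then (\<Sum>m\<in>UNIV. a m *\<^sub>R w m) else w i) = a k * det (\<chi> i. w i)"
  using cramer_lemma_transpose[of k "\<chi> m. a m" "\<chi> i. w i"]
  by (simp add: row_def scalar_mult_eq_scaleR cong: if_cong)

lemma det_shear_rows:
  fixes u w :: "'n::finite \<Rightarrow> real ^ 'n"
  assumes c: "c \<noteq> 0" "u j = c *\<^sub>R w j" and span: "\<And>i. i \<noteq> j \<Longrightarrow> u i - w i \<in> span {w j}"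
  shows "det (\<chi> i. u i) = c * det (\<chi> i. w i)"
proof -
  have "\<exists>a. u i = w i + a *\<^sub>R w j" if "i \<noteq> j" for i
    using span[OF that] unfolding span_singleton by (auto simp: algebra_simps)
  then obtain a where a: "\<And>i. i \<noteq> j \<Longrightarrow> u i = w i + a i *\<^sub>R w j" by metis
  define w' where "w' i = (if i = j then c *\<^sub>R w j else w i)" for i
  have "(\<chi> i. u i) = (\<chi> i. if i \<in> UNIV - {j} then w' i + (a i / c) *\<^sub>R w' j else w' i)"
    using c a by (auto simp: vec_eq_iff w'_def)
  then have "det (\<chi> i. u i) = det (\<chi> i. w' i)"
    using det_add_multiples_of_row[of "UNIV - {j}" j w' "\<lambda>i. a i / c"] by simp
  also have "(\<chi> i. w' i) = (\<chi> i. if i = j then c *s w j else w i)"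
    by (simp add: w'_def vec_eq_iff)
  also have "det \<dots> = c * det (\<chi> i. if i = j then w j else w i)" by (rule det_row_mul)
  also have "(\<chi> i. if i = j then w j else w i) = (\<chi> i. w i)" by (simp add: vec_eq_iff)
  finally show ?thesis .
qed

lemma inner_form_pullback:
  assumes G: "inner_form G" and L: "linear L" and nz: "\<And>v. v \<noteq> 0 \<Longrightarrow> L v \<noteq> 0"
  shows "inner_form (\<lambda>u v. G (L u) (L v))"
proof -
  note i = inner_form_simps[OF G]
  have l1: "linear (\<lambda>a. G a v)" for v using i(1) unfolding bilinear_def by auto
  have l2: "linear (G u)" for u using i(1) unfolding bilinear_def by auto
  have "linear (\<lambda>a. G (L a) (L v))" for v using linear_compose[OF L l1] by (simp add: o_def)
  moreover have "linear (\<lambda>a. G (L v) (L a))" for v using linear_compose[OF L l2] by (simp add: o_def)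
  moreover have "G (L u) (L v) = G (L v) (L u)" for u v by (rule i(2))
  ultimately show ?thesis unfolding inner_form_def bilinear_def using i(3) nz by blast
qed

text \<open>The pullback of the form at \<open>F x\<close> is again an inner product at \<open>x\<close>, so the Jacobian measures the change of
volume of every frame, not only of the coordinate frame.\<close>

lemma jacobian_gram:
  fixes A :: "('a, 'n::finite) chart set" and F :: "'a \<Rightarrow> 'a"
  assumes g: "\<And>y. inner_form (g y)" and L: "linear (tangent_map A F x)"
    and nz: "\<And>v. v \<noteq> 0 \<Longrightarrow> tangent_map A F x v \<noteq> 0"
  shows "0 < jacobian A g F x"
    and "gram (g (F x)) (\<lambda>i. tangent_map A F x (e i)) = (jacobian A g F x)\<^sup>2 * gram (g x) e"
proof -
  define G where "G u v = g (F x) (tangent_map A F x u) (tangent_map A F x v)" for u v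
  have G: "inner_form G" unfolding G_def by (rule inner_form_pullback[OF g L nz])
  have jac: "jacobian A g F x = sqrt (gram G (\<lambda>i. axis i 1) / gram (g x) (\<lambda>i. axis i 1))"
    unfolding jacobian_def gram_def G_def ..
  have p: "0 < gram G (\<lambda>i. axis i 1)" "0 < gram (g x) (\<lambda>i. axis i 1)"
    by (intro gram_axis_pos G g)+
  then show "0 < jacobian A g F x" unfolding jac by simp
  have "gram (g (F x)) (\<lambda>i. tangent_map A F x (e i)) = gram G e" unfolding gram_def G_def ..
  also have "\<dots> = gram G (\<lambda>i. axis i 1) * (det (\<chi> i. e i))\<^sup>2"
    by (rule gram_eq_det_squared[OF inner_form_simps(1)[OF G]])
  also have "\<dots> = (jacobian A g F x)\<^sup>2 * (gram (g x) (\<lambda>i. axis i 1) * (det (\<chi> i. e i))\<^sup>2)"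
    unfolding jac using p by simp
  also have "gram (g x) (\<lambda>i. axis i 1) * (det (\<chi> i. e i))\<^sup>2 = gram (g x) e"
    by (rule gram_eq_det_squared[OF inner_form_simps(1)[OF g], symmetric])
  finally show "gram (g (F x)) (\<lambda>i. tangent_map A F x (e i)) = (jacobian A g F x)\<^sup>2 * gram (g x) e" .
qed

lemma tnorm_simps:
  assumes "\<And>y. inner_form (g y)"
  shows "v \<noteq> 0 \<Longrightarrow> 0 < tnorm g z v" "(tnorm g z v)\<^sup>2 = g z v v"
    "tnorm g z (u + v) \<le> tnorm g z u + tnorm g z v" "tnorm g z (c *\<^sub>R v) = \<bar>c\<bar> * tnorm g z v"
proof -
  note i = inner_form_simps[OF assms]
  show "v \<noteq> 0 \<Longrightarrow> 0 < tnorm g z v" "(tnorm g z v)\<^sup>2 = g z v v"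
    using i(3,6) by (auto simp: tnorm_def)
  show "tnorm g z (u + v) \<le> tnorm g z u + tnorm g z v"
    unfolding tnorm_def by (rule inner_form_triangle[OF assms])
  show "tnorm g z (c *\<^sub>R v) = \<bar>c\<bar> * tnorm g z v"
    using bilinear_lmul[OF i(1)] bilinear_rmul[OF i(1)]
    by (simp add: tnorm_def real_sqrt_mult flip: mult.assoc)
qed

lemma det_independent_rows:
  fixes E :: "'n::finite \<Rightarrow> real ^ 'n"
  assumes inj: "inj E" and ind: "independent (range E)"
  shows "det (\<chi> i. E i) \<noteq> 0"
proof -
  have "c i = 0" if "(\<Sum>i\<in>UNIV. c i *s row i (\<chi> i. E i)) = 0" for c i
  proof -
    have "(\<Sum>v\<in>range E. c (inv E v) *\<^sub>R v) = (\<Sum>i\<in>UNIV. c i *\<^sub>R E i)"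
      using inj by (simp add: sum.reindex)
    also have "\<dots> = 0" using that by (simp add: row_def scalar_mult_eq_scaleR)
    finally have "c (inv E (E i)) = 0"
      using independentD[OF ind finite_imageI[OF finite] subset_refl, of "\<lambda>v. c (inv E v)"] by blast
    then show ?thesis using inj by simp
  qed
  then have "\<exists>B. (\<chi> i. E i) ** B = mat 1"
    using matrix_right_invertible_independent_rows[of "\<chi> i. E i"] by blast
  then show ?thesis by (simp add: invertible_det_nz[symmetric] invertible_right_inverse)
qed

lemma frame_expansion:
  fixes E :: "'n::finite \<Rightarrow> real ^ 'n"
  assumes inj: "inj E" and ind: "independent (range E)"
  obtains a where "v = (\<Sum>i\<in>UNIV. a i *\<^sub>R E i)"
proof -
  have "card (range E) = CARD('n)" using inj by (simp add: card_image)
  then have "UNIV \<subseteq> span (range E)"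
    using ind by (intro card_ge_dim_independent) auto
  then have "v \<in> span (range E)" by blast
  then obtain c where "v = (\<Sum>w\<in>range E. c w *\<^sub>R w)" by (auto simp: span_finite)
  then have "v = (\<Sum>i\<in>UNIV. c (E i) *\<^sub>R E i)" using inj by (simp add: sum.reindex)
  then show ?thesis by (rule that)
qed

section \<open>Bases adapted to the Oseledets splitting\<close>

text \<open>Uniqueness of the decomposition, stated with functions in a dependent product, turned into linear
independence of the union of bases of the summands.\<close>

lemma basis_of_direct_sum:
  fixes E :: "'i \<Rightarrow> 'v::euclidean_space set"
  assumes fin: "finite I" and sub: "\<And>c. c \<in> I \<Longrightarrow> subspace (E c)"
    and decomp: "\<And>v. \<exists>!w. w \<in> (\<Pi>\<^sub>E c\<in>I. E c) \<and> v = (\<Sum>c\<in>I. w c)"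
    and B: "\<And>c. c \<in> I \<Longrightarrow> B c \<subseteq> E c \<and> independent (B c) \<and> E c \<subseteq> span (B c)"
  shows "independent (\<Union>c\<in>I. B c)" and "span (\<Union>c\<in>I. B c) = UNIV"
    and "\<And>c d. c \<in> I \<Longrightarrow> d \<in> I \<Longrightarrow> c \<noteq> d \<Longrightarrow> B c \<inter> B d = {}"
proof -
  have uniq: "w c = w' c" if "\<And>c. c \<in> I \<Longrightarrow> w c \<in> E c" "\<And>c. c \<in> I \<Longrightarrow> w' c \<in> E c"
    "(\<Sum>c\<in>I. w c) = (\<Sum>c\<in>I. w' c)" "c \<in> I" for w w' c
  proof -
    have "restrict w I \<in> (\<Pi>\<^sub>E c\<in>I. E c)" "restrict w' I \<in> (\<Pi>\<^sub>E c\<in>I. E c)" using that by auto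
    moreover have "(\<Sum>c\<in>I. w c) = (\<Sum>c\<in>I. restrict w I c)" "(\<Sum>c\<in>I. w c) = (\<Sum>c\<in>I. restrict w' I c)"
      using that(3) by auto
    ultimately have "restrict w I = restrict w' I" using decomp[of "\<Sum>c\<in>I. w c"] by blast
    then show ?thesis using that(4) by (metis restrict_apply')
  qed
  have fB: "finite (B c)" if "c \<in> I" for c using B[OF that] independent_imp_finite by blast
  show disj: "B c \<inter> B d = {}" if "c \<in> I" "d \<in> I" "c \<noteq> d" for c d
  proof (rule ccontr)
    assume "B c \<inter> B d \<noteq> {}"
    then obtain b where b: "b \<in> B c" "b \<in> B d" by blast
    \<comment> \<open>a common vector \<open>b\<close> would have two decompositions, one in each summand\<close>
    have "(if c = c then b else 0) = (if c = d then b else 0)"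
    proof (rule uniq[where w = "\<lambda>i. if i = c then b else 0" and w' = "\<lambda>i. if i = d then b else 0"])
      show "(if i = c then b else 0) \<in> E i" "(if i = d then b else 0) \<in> E i" if "i \<in> I" for i
        using b B[of i] subspace_0[OF sub[OF that]] that by auto
      show "(\<Sum>i\<in>I. if i = c then b else 0) = (\<Sum>i\<in>I. if i = d then b else 0)"
        using that fin by simp
    qed (use that in auto)
    then have "b = 0" using that by simp
    then show False using b B[OF that(1)] dependent_zero by blast
  qed
  show "independent (\<Union>c\<in>I. B c)"
  proof (rule independent_if_scalars_zero)
    show "finite (\<Union>c\<in>I. B c)" using fin fB by blast
    fix f b assume s: "(\<Sum>b\<in>(\<Union>c\<in>I. B c). f b *\<^sub>R b) = 0" and "b \<in> (\<Union>c\<in>I. B c)"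
    then obtain c where c: "c \<in> I" "b \<in> B c" by blast
    have "(\<Sum>b\<in>B c. f b *\<^sub>R b) = 0"
    proof (rule uniq[where w = "\<lambda>c. \<Sum>b\<in>B c. f b *\<^sub>R b" and w' = "\<lambda>_. 0"])
      show "(\<Sum>b\<in>B c. f b *\<^sub>R b) \<in> E c" if "c \<in> I" for c
        using B[OF that] sub[OF that] by (intro subspace_sum subspace_scale) auto
      show "0 \<in> E c" if "c \<in> I" for c using subspace_0[OF sub[OF that]] .
      show "(\<Sum>c\<in>I. \<Sum>b\<in>B c. f b *\<^sub>R b) = (\<Sum>c\<in>I. 0)"
        using s sum.UNION_disjoint[of I B "\<lambda>b. f b *\<^sub>R b"] fin fB disj by simp
    qed (use c in auto)
    then show "f b = 0"
      using B[OF c(1)] fB[OF c(1)] c(2) independentD[of "B c" "B c" f b] by blast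
  qed
  show "span (\<Union>c\<in>I. B c) = UNIV"
  proof -
    have "v \<in> span (\<Union>c\<in>I. B c)" for v
    proof -
      obtain w where w: "w \<in> (\<Pi>\<^sub>E c\<in>I. E c)" "v = (\<Sum>c\<in>I. w c)" using decomp[of v] by blast
      have "w c \<in> span (\<Union>c\<in>I. B c)" if "c \<in> I" for c
        using w B[OF that] that span_mono[of "B c" "\<Union>c\<in>I. B c"] by (auto dest!: PiE_mem)
      then show ?thesis using w(2) by (auto intro: span_sum)
    qed
    then show ?thesis by auto
  qed
qed

lemma sorted_concat_replicate:
  fixes cs :: "real list"
  assumes "sorted cs"
  shows "sorted (concat (map (\<lambda>c. replicate (k c) c) cs))"
  using assms by (induction cs) (auto simp: sorted_append sorted_replicate)

text \<open>The bases are concatenated in the same order in which the exponents are listed with multiplicity, so that the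
\<open>i\<close>-th vector belongs to the \<open>i\<close>-th exponent.\<close>

lemma lyap_adapted_basis:
  fixes A :: "('a, 'n::finite) chart set"
  assumes reg: "lyap_regular A g \<phi> x"
  defines "\<Lambda> \<equiv> lyap_exponent A g \<phi> x"
  shows "\<exists>e. (\<forall>i\<in>{1..CARD('n)}. e i \<in> lyap_space A g \<phi> x (\<Lambda> i)) \<and>
           inj_on e {1..CARD('n)} \<and> independent (e ` {1..CARD('n)})"
    and "\<And>i j. 1 \<le> i \<Longrightarrow> i \<le> j \<Longrightarrow> j \<le> CARD('n) \<Longrightarrow> \<Lambda> i \<le> \<Lambda> j"
    and "(\<Sum>i=1..CARD('n). \<Lambda> i) =
           (\<Sum>c\<in>lyap_values A g \<phi> x. real (dim (lyap_space A g \<phi> x c)) * c)"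
proof -
  define I where "I = lyap_values A g \<phi> x"
  define E where "E = lyap_space A g \<phi> x"
  have fin: "finite I" and sub: "\<And>c. c \<in> I \<Longrightarrow> subspace (E c)"
    and decomp: "\<And>v. \<exists>!w. w \<in> (\<Pi>\<^sub>E c\<in>I. E c) \<and> v = (\<Sum>c\<in>I. w c)"
    using reg unfolding lyap_regular_def I_def E_def by auto
  have "\<exists>ls. set ls \<subseteq> E c \<and> independent (set ls) \<and> E c \<subseteq> span (set ls) \<and> distinct ls \<and> length ls = dim (E c)" for c
  proof -
    obtain B where B: "B \<subseteq> E c" "independent B" "E c \<subseteq> span B" "card B = dim (E c)"
      by (rule basis_exists)
    obtain ls where "set ls = B" "distinct ls"
      using finite_distinct_list[OF independent_imp_finite[OF B(2)]] by blast
    then show ?thesis using B by (metis distinct_card)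
  qed
  then obtain ls where ls: "\<And>c. set (ls c) \<subseteq> E c \<and> independent (set (ls c)) \<and> E c \<subseteq> span (set (ls c)) \<and>
      distinct (ls c) \<and> length (ls c) = dim (E c)" by metis
  define cs where "cs = sorted_list_of_set I"
  have cs: "set cs = I" "distinct cs" "sorted cs" unfolding cs_def using fin by auto
  define bs where "bs = concat (map ls cs)"
  define L where "L = concat (map (\<lambda>c. replicate (dim (E c)) c) cs)"
  have lam: "\<Lambda> i = L ! (i - 1)" for i
    unfolding \<Lambda>_def lyap_exponent_def L_def cs_def E_def I_def ..
  note basis = basis_of_direct_sum[OF fin sub decomp, of "\<lambda>c. set (ls c)"]
  have set_bs: "set bs = (\<Union>c\<in>I. set (ls c))" unfolding bs_def using cs by auto
  have ind: "independent (set bs)" and sp: "span (set bs) = UNIV"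
    unfolding set_bs using basis ls by auto
  have disj: "set (ls c) \<inter> set (ls d) = {}" if "c \<in> I" "d \<in> I" "c \<noteq> d" for c d
    using basis(3) ls that by blast
  have "distinct (concat (map ls cs'))" if "distinct cs'" "set cs' \<subseteq> I" for cs'
    using that
  proof (induction cs')
    case (Cons c cs')
    have "set (ls c) \<inter> set (ls d) = {}" if "d \<in> set cs'" for d
      using Cons.prems that by (intro disj) auto
    then show ?case using Cons ls[of c] by auto
  qed simp
  then have dist: "distinct bs" unfolding bs_def using cs by blast
  have len: "length bs = CARD('n)"
    using distinct_card[OF dist] ind sp dim_span_eq_card_independent[OF ind] by simp
  have "list_all2 (\<lambda>b c. b \<in> E c) (concat (map ls cs')) (concat (map (\<lambda>c. replicate (dim (E c)) c) cs'))" for cs'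
  proof (induction cs')
    case (Cons c cs')
    have "list_all2 (\<lambda>b c. b \<in> E c) (ls c) (replicate (dim (E c)) c)"
      using ls[of c] by (auto simp: list_all2_conv_all_nth)
    then show ?case using Cons by (auto intro: list_all2_appendI)
  qed simp
  then have la: "list_all2 (\<lambda>b c. b \<in> E c) bs L" unfolding bs_def L_def .
  have lenL: "length L = CARD('n)" using list_all2_lengthD[OF la] len by simp
  show "\<exists>e. (\<forall>i\<in>{1..CARD('n)}. e i \<in> lyap_space A g \<phi> x (\<Lambda> i)) \<and>
           inj_on e {1..CARD('n)} \<and> independent (e ` {1..CARD('n)})"
  proof (intro exI[of _ "\<lambda>i. bs ! (i - 1)"] conjI ballI)
    show "bs ! (i - 1) \<in> lyap_space A g \<phi> x (\<Lambda> i)" if "i \<in> {1..CARD('n)}" for i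
      unfolding lam E_def[symmetric] using list_all2_nthD[OF la, of "i - 1"] len that by auto
    show "inj_on (\<lambda>i. bs ! (i - 1)) {1..CARD('n)}"
      using dist len by (auto simp: inj_on_def nth_eq_iff_index_eq)
    have "(\<lambda>i. bs ! (i - 1)) ` {1..CARD('n)} \<subseteq> set bs" using len by auto
    then show "independent ((\<lambda>i. bs ! (i - 1)) ` {1..CARD('n)})" using ind independent_mono by blast
  qed
  show "\<Lambda> i \<le> \<Lambda> j" if "1 \<le> i" "i \<le> j" "j \<le> CARD('n)" for i j
    unfolding lam L_def
    by (rule sorted_nth_mono[OF sorted_concat_replicate[OF cs(3)]])
      (use that lenL in \<open>auto simp: L_def\<close>)
  have "(\<Sum>i=1..CARD('n). \<Lambda> i) = (\<Sum>i<CARD('n). L ! i)"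
    unfolding lam by (rule sum.reindex_bij_witness[of _ Suc "\<lambda>i. i - 1"]) auto
  also have "\<dots> = sum_list L" by (simp add: sum_list_sum_nth lenL atLeast0LessThan)
  also have "\<dots> = sum_list (map (\<lambda>c. real (dim (E c)) * c) cs)"
    unfolding L_def by (induction cs) (auto simp: sum_list_replicate)
  also have "\<dots> = (\<Sum>c\<in>I. real (dim (E c)) * c)" using cs by (simp add: sum_list_distinct_conv_sum_set)
  finally show "(\<Sum>i=1..CARD('n). \<Lambda> i) =
           (\<Sum>c\<in>lyap_values A g \<phi> x. real (dim (lyap_space A g \<phi> x c)) * c)"
    unfolding I_def E_def .
qed

lemma lyap_space_tendsto:
  assumes "v \<in> lyap_space A g \<phi> x c" "v \<noteq> 0"
  shows "((\<lambda>t. 1 / t * ln (tnorm g (\<phi> t x) (tangent_map A (\<phi> t) x v))) \<longlongrightarrow> c) at_top"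
  using assms unfolding lyap_space_def tendsto_both_ends_def by blast

section \<open>Real functions and derivatives\<close>

lemma strict_mono_surj_continuous:
  fixes h :: "real \<Rightarrow> real"
  assumes "strict_mono h" "surj h"
  shows "continuous_on UNIV h"
  by (rule continuous_onI_mono) (use assms in \<open>auto simp: strict_mono_less_eq\<close>)

lemma strict_mono_surj_at_top:
  fixes h :: "real \<Rightarrow> real"
  assumes "strict_mono h" "surj h"
  shows "filterlim h at_top at_top"
  unfolding filterlim_at_top
proof
  fix Z
  obtain a where a: "h a = Z" using assms(2) by (metis surjD)
  show "eventually (\<lambda>s. Z \<le> h s) at_top"
    by (rule eventually_at_top_linorderI[of a]) (use a strict_mono_less_eq[OF assms(1)] in blast)
qed

lemma const_over_time: "((\<lambda>\<tau>::real. 1 / \<tau> * c) \<longlongrightarrow> 0) at_top"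
proof -
  have "((\<lambda>\<tau>::real. inverse \<tau> * c) \<longlongrightarrow> 0 * c) at_top"
    by (intro tendsto_mult tendsto_const tendsto_inverse_0_at_top filterlim_ident)
  then show ?thesis by (simp add: divide_inverse)
qed

text \<open>Convergence of \<open>s t / t\<close> forces \<open>(s (2 * t) - s t) / t\<close> to converge to the same limit \<open>R\<close>. By the mean value theorem
this quotient is a value of \<open>\<rho>\<close> at a later time, which would be at least \<open>2 * R\<close> if \<open>\<rho>\<close> grew exponentially
and at most \<open>R / 2\<close> if it decayed exponentially.\<close>

lemma exponential_rate_of_speed_zero:
  fixes s \<rho> :: "real \<Rightarrow> real"
  assumes der: "\<And>t. (s has_real_derivative \<rho> t) (at t)" and pos: "\<And>t. 0 < \<rho> t"
    and avg: "((\<lambda>t. s t / t) \<longlongrightarrow> R) at_top" "0 < R"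
    and rate: "((\<lambda>t. ln (\<rho> t) / t) \<longlongrightarrow> \<kappa>) at_top"
  shows "\<kappa> = 0"
proof -
  have "((\<lambda>t. s (2 * t) / (2 * t)) \<longlongrightarrow> R) at_top"
    by (rule filterlim_compose[OF avg(1)])
      (rule filterlim_tendsto_pos_mult_at_top[OF tendsto_const _ filterlim_ident], simp)
  from tendsto_diff[OF tendsto_mult[OF tendsto_const[of 2] this] avg(1)]
  have lim: "((\<lambda>t. 2 * (s (2 * t) / (2 * t)) - s t / t) \<longlongrightarrow> R) at_top" by simp
  have MVT: "\<exists>\<xi>>t. 2 * (s (2 * t) / (2 * t)) - s t / t = \<rho> \<xi>" if "0 < t" for t
  proof -
    obtain \<xi> where "t < \<xi>" "s (2 * t) - s t = (2 * t - t) * \<rho> \<xi>"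
      using MVT2[of t "2 * t" s \<rho>] der \<open>0 < t\<close> by auto
    then show ?thesis using that by (intro exI[of _ \<xi>]) (simp add: field_simps)
  qed
  have transfer: "eventually (\<lambda>t. P (2 * (s (2 * t) / (2 * t)) - s t / t)) at_top"
    if P: "eventually (\<lambda>t. P (\<rho> t)) at_top" for P
  proof -
    obtain t0 where t0: "\<And>t. t \<ge> t0 \<Longrightarrow> P (\<rho> t)" using P unfolding eventually_at_top_linorder by blast
    show ?thesis
    proof (rule eventually_at_top_linorderI[of "max 1 t0"])
      fix t assume t: "max 1 t0 \<le> t"
      then obtain \<xi> where "\<xi> > t" "2 * (s (2 * t) / (2 * t)) - s t / t = \<rho> \<xi>" using MVT[of t] by auto
      then show "P (2 * (s (2 * t) / (2 * t)) - s t / t)" using t0[of \<xi>] t by auto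
    qed
  qed
  have log: "eventually (\<lambda>t. ln (\<rho> t) / t * t = ln (\<rho> t)) at_top"
    by (rule eventually_at_top_linorderI[of 1]) simp
  consider "\<kappa> > 0" | "\<kappa> < 0" | "\<kappa> = 0" by linarith
  then show ?thesis
  proof cases
    case 1
    have "filterlim (\<lambda>t. ln (\<rho> t) / t * t) at_top at_top"
      by (rule filterlim_tendsto_pos_mult_at_top[OF rate 1 filterlim_ident])
    then have "filterlim (\<lambda>t. ln (\<rho> t)) at_top at_top"
      using filterlim_cong[OF refl refl log] by blast
    then have "eventually (\<lambda>t. ln (2 * R) \<le> ln (\<rho> t)) at_top" by (simp add: filterlim_at_top)
    then have "eventually (\<lambda>t. 2 * R \<le> \<rho> t) at_top"
      by eventually_elim (use avg(2) pos in simp)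
    from tendsto_lowerbound[OF lim transfer[OF this]] show ?thesis using avg(2) by simp
  next
    case 2
    have "filterlim (\<lambda>t. ln (\<rho> t) / t * t) at_bot at_top"
      by (rule filterlim_tendsto_neg_mult_at_bot[OF rate 2 filterlim_ident])
    then have "filterlim (\<lambda>t. ln (\<rho> t)) at_bot at_top"
      using filterlim_cong[OF refl refl log] by blast
    then have "eventually (\<lambda>t. ln (\<rho> t) \<le> ln (R / 2)) at_top" by (simp add: filterlim_at_bot)
    then have "eventually (\<lambda>t. \<rho> t \<le> R / 2) at_top"
      by eventually_elim (use avg(2) pos in simp)
    from tendsto_upperbound[OF lim transfer[OF this]] show ?thesis using avg(2) by simp
  qed
qed

lemma has_vector_derivative_eventually_eq:
  assumes "(f has_vector_derivative D) (at x)" "eventually (\<lambda>y. f y = g y) (nhds x)"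
  shows "(g has_vector_derivative D) (at x)"
proof -
  have "f x = g x" using eventually_nhds_x_imp_x[OF assms(2)] .
  then show ?thesis
    using has_vector_derivative_cong_ev[of UNIV f g x D] assms by simp
qed

text \<open>Here \<open>\<theta>\<close> is only assumed continuous at \<open>y0\<close>. Comparing \<open>u y = w (\<theta> y, y)\<close> with the two
first order expansions bounds \<open>\<theta> y - t\<close> by a multiple of \<open>norm (y - y0)\<close>; thus \<open>U v - W (0, v)\<close> is a limit
of multiples of \<open>W (1, 0)\<close>, and a line is closed. For flows this spares the proof that the elapsed time is
differentiable in the initial point.\<close>

lemma derivative_difference_in_time_direction:
  fixes w :: "real \<times> 'b::real_normed_vector \<Rightarrow> 'c::euclidean_space"
  assumes W: "(w has_derivative W) (at (t, y0))" and U: "(u has_derivative U) (at y0)"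
    and \<theta>: "(\<theta> \<longlongrightarrow> t) (at y0)" and eq0: "u y0 = w (t, y0)"
    and eq: "eventually (\<lambda>y. u y = w (\<theta> y, y)) (at y0)" and nz: "W (1, 0) \<noteq> 0"
  shows "U v - W (0, v) \<in> span {W (1, 0)}"
proof (cases "v = 0")
  case True
  have "W (0, 0) = 0" using W has_derivative_linear linear_0 by (metis zero_prod_def)
  then show ?thesis
    using True linear_0[OF has_derivative_linear[OF U]] by (simp add: span_zero)
next
  case False
  define p where "p = W (1, 0)"
  define q where "q = U v - W (0, v)"
  define K where "K = 2 * (norm q + 2 * norm v) / norm p"
  have p: "norm p > 0" using nz p_def by simp
  have K: "K \<ge> 0" unfolding K_def using p by simp
  have linW: "linear W" and linU: "linear U" using W U has_derivative_linear by auto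
  have "q \<in> closure (span {p})"
    unfolding closure_approachable
  proof (intro allI impI)
    fix e :: real assume e: "0 < e"
    \<comment> \<open>the second bound absorbs the error \<open>\<eta> * \<bar>\<Delta>\<bar>\<close> into \<open>\<bar>\<Delta>\<bar> * norm p\<close>; the third makes the final error less than \<open>e\<close>\<close>
    define \<eta> where "\<eta> = min (min 1 (norm p / 2)) (e / (2 * (K + 2 * norm v + 1)))"
    have den: "K + 2 * norm v + 1 > 0" using K norm_ge_zero[of v] by linarith
    have \<eta>: "0 < \<eta>" "\<eta> \<le> 1" "\<eta> \<le> norm p / 2" "\<eta> \<le> e / (2 * (K + 2 * norm v + 1))"
    proof -
      show "0 < \<eta>" unfolding \<eta>_def using p e den by auto
      show "\<eta> \<le> 1" "\<eta> \<le> norm p / 2" "\<eta> \<le> e / (2 * (K + 2 * norm v + 1))"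
        unfolding \<eta>_def
        by (rule order_trans[OF min.cobounded1 min.cobounded1] order_trans[OF min.cobounded1 min.cobounded2] min.cobounded2)+
    qed
    obtain d1 where d1: "d1 > 0"
      "\<And>y. norm (y - y0) < d1 \<Longrightarrow> norm (u y - u y0 - U (y - y0)) \<le> \<eta> * norm (y - y0)"
      using U \<eta>(1) unfolding has_derivative_at_alt by blast
    obtain d2 where d2: "d2 > 0"
      "\<And>z. norm (z - (t, y0)) < d2 \<Longrightarrow> norm (w z - w (t, y0) - W (z - (t, y0))) \<le> \<eta> * norm (z - (t, y0))"
      using W \<eta>(1) unfolding has_derivative_at_alt by blast
    have "eventually (\<lambda>y. \<bar>\<theta> y - t\<bar> < d2 / 2 \<and> u y = w (\<theta> y, y)) (at y0)"
      using eventually_conj[OF tendstoD[OF \<theta>, of "d2 / 2"] eq] d2 by (simp add: dist_real_def)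
    then obtain d3 where d3: "d3 > 0"
      "\<And>y. y \<noteq> y0 \<Longrightarrow> dist y y0 < d3 \<Longrightarrow> \<bar>\<theta> y - t\<bar> < d2 / 2 \<and> u y = w (\<theta> y, y)"
      unfolding eventually_at by blast
    define \<delta> where "\<delta> = min d1 (min (d2 / 2) d3)"
    define h where "h = \<delta> / (2 * norm v)"
    have \<delta>: "\<delta> > 0" "\<delta> \<le> d1" "\<delta> \<le> d2 / 2" "\<delta> \<le> d3" unfolding \<delta>_def using d1 d2 d3 by auto
    have h: "h > 0" "h * norm v < \<delta>" unfolding h_def using \<delta> False by auto
    define y where "y = y0 + h *\<^sub>R v"
    define \<Delta> where "\<Delta> = \<theta> y - t"
    have y: "y \<noteq> y0" "norm (y - y0) = h * norm v" "y - y0 = h *\<^sub>R v"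
      unfolding y_def using h False by auto
    have \<Delta>: "\<bar>\<Delta>\<bar> < d2 / 2" and uy: "u y = w (\<theta> y, y)"
      using d3(2)[OF y(1)] y(2) h \<delta> unfolding \<Delta>_def dist_norm by auto
    define E1 where "E1 = u y - u y0 - U (y - y0)"
    define E2 where "E2 = w (\<theta> y, y) - w (t, y0) - W (\<Delta>, y - y0)"
    have E1: "norm E1 \<le> \<eta> * (h * norm v)" unfolding E1_def using d1(2)[of y] y h \<delta> by auto
    have nz2: "norm ((\<theta> y, y) - (t, y0)) \<le> \<bar>\<Delta>\<bar> + h * norm v"
      using norm_Pair_le[of \<Delta> "y - y0"] y(2) by (simp add: \<Delta>_def)
    have "norm E2 \<le> \<eta> * norm ((\<theta> y, y) - (t, y0))"
      unfolding E2_def \<Delta>_def using d2(2)[of "(\<theta> y, y)"] nz2 \<Delta> h \<delta> by auto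
    also have "\<dots> \<le> \<eta> * (\<bar>\<Delta>\<bar> + h * norm v)" using nz2 \<eta> by (intro mult_left_mono) auto
    finally have E2: "norm E2 \<le> \<eta> * (\<bar>\<Delta>\<bar> + h * norm v)" .
    have WD: "W (\<Delta>, y - y0) = \<Delta> *\<^sub>R p + h *\<^sub>R W (0, v)"
    proof -
      have "(\<Delta>, y - y0) = \<Delta> *\<^sub>R (1, 0) + h *\<^sub>R (0, v)" using y(3) by simp
      then show ?thesis unfolding p_def by (simp only: linear_add[OF linW] linear_cmul[OF linW])
    qed
    have "U (y - y0) = h *\<^sub>R U v" using y(3) linear_cmul[OF linU] by simp
    then have hq: "h *\<^sub>R q = \<Delta> *\<^sub>R p + E2 - E1"
      unfolding q_def E1_def E2_def WD using uy eq0 by (simp add: algebra_simps)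
    have "\<bar>\<Delta>\<bar> * norm p = norm (h *\<^sub>R q - E2 + E1)" using hq by simp
    also have "\<dots> \<le> norm (h *\<^sub>R q) + norm E2 + norm E1"
      by (intro order_trans[OF norm_triangle_ineq] add_right_mono norm_triangle_ineq4)
    also have "\<dots> \<le> h * norm q + \<eta> * \<bar>\<Delta>\<bar> + \<eta> * (2 * h * norm v)"
      using E1 E2 h by (simp add: algebra_simps)
    also have "\<dots> \<le> h * norm q + norm p / 2 * \<bar>\<Delta>\<bar> + 1 * (2 * h * norm v)"
      using \<eta> h by (intro add_mono mult_right_mono) auto
    finally have "\<bar>\<Delta>\<bar> * norm p \<le> 2 * (h * (norm q + 2 * norm v))" by (simp add: algebra_simps)
    then have \<Delta>K: "\<bar>\<Delta>\<bar> \<le> h * K" unfolding K_def using p by (simp add: field_simps)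
    have "h * norm (q - (\<Delta> / h) *\<^sub>R p) = norm (h *\<^sub>R (q - (\<Delta> / h) *\<^sub>R p))" using h by simp
    also have "h *\<^sub>R (q - (\<Delta> / h) *\<^sub>R p) = E2 - E1" using hq h by (simp add: algebra_simps)
    also have "norm (E2 - E1) \<le> \<eta> * (h * K + h * norm v) + \<eta> * (h * norm v)"
    proof -
      have "\<eta> * (\<bar>\<Delta>\<bar> + h * norm v) \<le> \<eta> * (h * K + h * norm v)"
        using \<Delta>K \<eta>(1) by (intro mult_left_mono) auto
      then show ?thesis using norm_triangle_ineq4[of E2 E1] E1 E2 by linarith
    qed
    also have "\<dots> = h * (\<eta> * (K + 2 * norm v))" by (simp add: algebra_simps)
    finally have "norm (q - (\<Delta> / h) *\<^sub>R p) \<le> \<eta> * (K + 2 * norm v)" using h by simp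
    also have "\<dots> \<le> \<eta> * (K + 2 * norm v + 1)" using \<eta> by simp
    also have "\<dots> \<le> e / (2 * (K + 2 * norm v + 1)) * (K + 2 * norm v + 1)"
      using \<eta> den by (intro mult_right_mono) auto
    also have "\<dots> = e / 2" using den by (simp add: field_simps)
    finally have "dist ((\<Delta> / h) *\<^sub>R p) q < e" using e by (simp add: dist_norm norm_minus_commute)
    then show "\<exists>y\<in>span {p}. dist y q < e" by (meson span_base span_scale singletonI)
  qed
  then show ?thesis unfolding p_def q_def by (simp add: closure_closed closed_span)
qed

section \<open>Tangent maps of a flow\<close>

lemma chart_at_manifold:
  fixes A :: "('a::topological_space, 'n::finite) chart set"
  assumes "Ck_manifold m A"
  shows "chart_at A x \<in> A" and "x \<in> fst (chart_at A x)"
proof -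
  obtain C where "C \<in> A" "x \<in> fst C" using assms unfolding Ck_manifold_def by blast
  then have "chart_at A x \<in> A \<and> x \<in> fst (chart_at A x)"
    unfolding chart_at_def by (intro someI[of "\<lambda>C. C \<in> A \<and> x \<in> fst C" C]) auto
  then show "chart_at A x \<in> A" and "x \<in> fst (chart_at A x)" by auto
qed

lemma chart_simps:
  assumes "is_chart C"
  shows "open (fst C)" "open (snd C ` fst C)" "continuous_on (fst C) (snd C)"
    "continuous_on (snd C ` fst C) (chart_inv C)"
    "y \<in> fst C \<Longrightarrow> chart_inv C (snd C y) = y"
    "z \<in> snd C ` fst C \<Longrightarrow> chart_inv C z \<in> fst C"
    "z \<in> snd C ` fst C \<Longrightarrow> snd C (chart_inv C z) = z"
  using assms unfolding is_chart_def homeomorphism_def by auto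

locale C1_flow =
  fixes A :: "('a::{t2_space, second_countable_topology}, 'n::finite) chart set"
    and m l :: nat and \<Phi> :: "real \<Rightarrow> 'a \<Rightarrow> 'a"
  assumes manifold: "Ck_manifold m A" and l: "1 \<le> l" and flow: "Ck_flow A l \<Phi>"
begin

lemma flow_0: "\<Phi> 0 x = x" and flow_add: "\<Phi> (s + t) x = \<Phi> s (\<Phi> t x)"
  and flow_continuous: "continuous_on UNIV (\<lambda>(t, x). \<Phi> t x)"
  using flow unfolding Ck_flow_def by auto

lemma flow_isCont_time: "isCont (\<lambda>s. \<Phi> s x) t"
proof -
  have "continuous_on UNIV (\<lambda>s. (\<lambda>(t, x). \<Phi> t x) (s, x))"
    by (intro continuous_on_compose2[OF flow_continuous] continuous_intros) auto
  then show ?thesis by (simp add: continuous_on_eq_continuous_at)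
qed

lemma flow_isCont_space: "isCont (\<Phi> t) x"
proof -
  have "continuous_on UNIV (\<lambda>x. (\<lambda>(t, x). \<Phi> t x) (t, x))"
    by (intro continuous_on_compose2[OF flow_continuous] continuous_intros) auto
  then show ?thesis by (simp add: continuous_on_eq_continuous_at)
qed

abbreviation "ch \<equiv> chart_at A"

lemma ch_simps:
  "x \<in> fst (ch x)" "open (fst (ch x))" "open (snd (ch x) ` fst (ch x))"
  "continuous_on (fst (ch x)) (snd (ch x))"
  "continuous_on (snd (ch x) ` fst (ch x)) (chart_inv (ch x))"
  "y \<in> fst (ch x) \<Longrightarrow> chart_inv (ch x) (snd (ch x) y) = y"
  "z \<in> snd (ch x) ` fst (ch x) \<Longrightarrow> chart_inv (ch x) z \<in> fst (ch x)"
  "z \<in> snd (ch x) ` fst (ch x) \<Longrightarrow> snd (ch x) (chart_inv (ch x) z) = z"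
  "chart_inv (ch x) (snd (ch x) x) = x"
proof -
  have c: "is_chart (ch x)" using chart_at_manifold(1)[OF manifold, of x] manifold unfolding Ck_manifold_def by blast
  show "x \<in> fst (ch x)" using chart_at_manifold(2)[OF manifold] .
  then show "chart_inv (ch x) (snd (ch x) x) = x" using chart_simps[OF c] by blast
qed (use chart_at_manifold(1)[OF manifold, of x] manifold chart_simps[of "ch x"] in \<open>auto simp: Ck_manifold_def\<close>)

text \<open>The flow near \<open>(t, x)\<close> in the charts chosen at \<open>x\<close> and at \<open>\<Phi> t x\<close>; the second chart stays that of \<open>\<Phi> t x\<close> while
\<open>s\<close> varies.\<close>

definition local_flow :: "real \<Rightarrow> 'a \<Rightarrow> real \<times> (real ^ 'n) \<Rightarrow> real ^ 'n" where
  "local_flow t x = (\<lambda>(s, y). snd (ch (\<Phi> t x)) (\<Phi> s (chart_inv (ch x) y)))"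

lemma local_flow_differentiable: "local_flow t x differentiable (at (t, snd (ch x) x))"
proof -
  obtain k where k: "l = Suc k" using l by (cases l) auto
  have "ch x \<in> A" "ch (\<Phi> t x) \<in> A" using chart_at_manifold[OF manifold] by auto
  then have "\<forall>z\<in>{(s, y). y \<in> snd (ch x) ` fst (ch x) \<and> \<Phi> s (chart_inv (ch x) y) \<in> fst (ch (\<Phi> t x))}.
      local_flow t x differentiable (at z)"
    using flow unfolding Ck_flow_def k Ck_on.simps local_flow_def by simp
  then show ?thesis using ch_simps by (auto elim!: ballE[of _ _ "(t, snd (ch x) x)"])
qed

lemma local_flow_has_derivative:
  "(local_flow t x has_derivative frechet_derivative (local_flow t x) (at (t, snd (ch x) x))) (at (t, snd (ch x) x))"
  using local_flow_differentiable frechet_derivative_works by blast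

lemma tangent_map_eq_partial:
  "(snd (ch (\<Phi> t x)) \<circ> \<Phi> t \<circ> chart_inv (ch x) has_derivative tangent_map A (\<Phi> t) x) (at (snd (ch x) x))"
  "tangent_map A (\<Phi> t) x v = frechet_derivative (local_flow t x) (at (t, snd (ch x) x)) (0, v)"
proof -
  let ?W = "frechet_derivative (local_flow t x) (at (t, snd (ch x) x))"
  have "((\<lambda>y. (t, y)) has_derivative (\<lambda>v. (0, v))) (at (snd (ch x) x))"
    by (auto intro!: derivative_eq_intros)
  then have "(local_flow t x \<circ> (\<lambda>y. (t, y)) has_derivative ?W \<circ> (\<lambda>v. (0, v))) (at (snd (ch x) x))"
    by (rule diff_chain_at) (rule local_flow_has_derivative)
  moreover have "local_flow t x \<circ> (\<lambda>y. (t, y)) = snd (ch (\<Phi> t x)) \<circ> \<Phi> t \<circ> chart_inv (ch x)"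
    by (auto simp: local_flow_def)
  ultimately have d: "(snd (ch (\<Phi> t x)) \<circ> \<Phi> t \<circ> chart_inv (ch x) has_derivative ?W \<circ> (\<lambda>v. (0, v))) (at (snd (ch x) x))"
    by simp
  have "tangent_map A (\<Phi> t) x = ?W \<circ> (\<lambda>v. (0, v))"
    unfolding tangent_map_def using frechet_derivative_at[OF d] by auto
  then show "(snd (ch (\<Phi> t x)) \<circ> \<Phi> t \<circ> chart_inv (ch x) has_derivative tangent_map A (\<Phi> t) x) (at (snd (ch x) x))"
    "tangent_map A (\<Phi> t) x v = ?W (0, v)"
    using d by auto
qed

lemma tangent_map_linear: "linear (tangent_map A (\<Phi> t) x)"
  using tangent_map_eq_partial(1) has_derivative_linear by blast

text \<open>Tangent maps are evaluated on curves below: chain rules for compositions of flow maps then become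
identities between curves, without an explicit change of charts.\<close>

lemma tangent_map_curve:
  assumes \<gamma>: "isCont \<gamma> s0" "\<gamma> s0 = x" "((\<lambda>s. snd (ch x) (\<gamma> s)) has_vector_derivative v) (at s0)"
  shows "((\<lambda>s. snd (ch (\<Phi> t x)) (\<Phi> t (\<gamma> s))) has_vector_derivative tangent_map A (\<Phi> t) x v) (at s0)"
proof -
  have "(snd (ch (\<Phi> t x)) \<circ> \<Phi> t \<circ> chart_inv (ch x) has_derivative tangent_map A (\<Phi> t) x) (at (snd (ch x) (\<gamma> s0)))"
    using tangent_map_eq_partial(1) \<gamma>(2) by simp
  from diff_chain_at[OF \<gamma>(3)[unfolded has_vector_derivative_def] this]
  have "(snd (ch (\<Phi> t x)) \<circ> \<Phi> t \<circ> chart_inv (ch x) \<circ> (\<lambda>s. snd (ch x) (\<gamma> s)) has_vector_derivative tangent_map A (\<Phi> t) x v) (at s0)"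
    unfolding has_vector_derivative_def
    by (simp add: o_def linear_cmul[OF tangent_map_linear])
  moreover have ev: "eventually (\<lambda>s. \<gamma> s \<in> fst (ch x)) (nhds s0)"
    using \<gamma>(1,2) ch_simps(1,2)[of x] unfolding isCont_def
    by (metis tendsto_nhds_iff topological_tendstoD)
  then have "eventually (\<lambda>s. (snd (ch (\<Phi> t x)) \<circ> \<Phi> t \<circ> chart_inv (ch x) \<circ> (\<lambda>s. snd (ch x) (\<gamma> s))) s
      = snd (ch (\<Phi> t x)) (\<Phi> t (\<gamma> s))) (nhds s0)"
    by eventually_elim (simp add: ch_simps)
  ultimately show ?thesis by (rule has_vector_derivative_eventually_eq)
qed

lemma tangent_map_inverse: "tangent_map A (\<Phi> (- t)) (\<Phi> t x) (tangent_map A (\<Phi> t) x v) = v"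
proof -
  define c where "c s = snd (ch x) x + s *\<^sub>R v" for s :: real
  define \<gamma> where "\<gamma> s = chart_inv (ch x) (c s)" for s
  have c0: "c 0 = snd (ch x) x" and \<gamma>0: "\<gamma> 0 = x" by (auto simp: c_def \<gamma>_def ch_simps)
  have cc: "isCont c 0" unfolding c_def by (intro continuous_intros)
  have "isCont (chart_inv (ch x)) (c 0)"
    using ch_simps(1,3,5)[of x] c0 by (metis continuous_on_eq_continuous_at imageI)
  then have cont: "isCont \<gamma> 0" unfolding \<gamma>_def using isCont_o2[OF cc] by blast
  have ev: "eventually (\<lambda>s. c s \<in> snd (ch x) ` fst (ch x)) (nhds 0)"
  proof -
    have "(c \<longlongrightarrow> c 0) (nhds 0)" using cc unfolding isCont_def by (simp add: tendsto_nhds_iff)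
    then show ?thesis using topological_tendstoD[of c "c 0" "nhds 0"] ch_simps(1,3)[of x] c0 by auto
  qed
  then have ev2: "eventually (\<lambda>s. snd (ch x) (\<gamma> s) = c s) (nhds 0)"
    by eventually_elim (simp add: \<gamma>_def ch_simps)
  have "(c has_vector_derivative v) (at 0)"
    unfolding c_def by (auto intro!: derivative_eq_intros)
  then have d: "((\<lambda>s. snd (ch x) (\<gamma> s)) has_vector_derivative v) (at 0)"
    by (rule has_vector_derivative_eventually_eq) (use ev2 in \<open>simp add: eq_commute\<close>)
  have inv: "\<Phi> (- t) (\<Phi> t y) = y" for y using flow_add[of "- t" t y] by (simp add: flow_0)
  have d1: "((\<lambda>s. snd (ch (\<Phi> t x)) (\<Phi> t (\<gamma> s))) has_vector_derivative tangent_map A (\<Phi> t) x v) (at 0)"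
    by (rule tangent_map_curve[OF cont \<gamma>0 d])
  have c1: "isCont (\<lambda>s. \<Phi> t (\<gamma> s)) 0"
    using isCont_o2[OF cont] flow_isCont_space by blast
  have \<gamma>t: "\<Phi> t (\<gamma> 0) = \<Phi> t x" unfolding \<gamma>0 ..
  have "((\<lambda>s. snd (ch (\<Phi> (- t) (\<Phi> t x))) (\<Phi> (- t) (\<Phi> t (\<gamma> s)))) has_vector_derivative
      tangent_map A (\<Phi> (- t)) (\<Phi> t x) (tangent_map A (\<Phi> t) x v)) (at 0)"
    by (rule tangent_map_curve[OF c1 \<gamma>t d1])
  then have "((\<lambda>s. snd (ch x) (\<gamma> s)) has_vector_derivative
      tangent_map A (\<Phi> (- t)) (\<Phi> t x) (tangent_map A (\<Phi> t) x v)) (at 0)"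
    unfolding inv .
  then show ?thesis using d by (rule vector_derivative_unique_at)
qed

lemma tangent_map_nonzero: "v \<noteq> 0 \<Longrightarrow> tangent_map A (\<Phi> t) x v \<noteq> 0"
  by (metis tangent_map_inverse tangent_map_linear linear_0)

end

locale generated_flow = C1_flow A m l \<Phi>
  for A :: "('a::{t2_space, second_countable_topology}, 'n::finite) chart set" and m l \<Phi> +
  fixes f :: "'a \<Rightarrow> real ^ 'n"
  assumes gen: "generates A f \<Phi>"
begin

lemma orbit_derivative: "((\<lambda>s. snd (ch (\<Phi> t x)) (\<Phi> s x)) has_vector_derivative f (\<Phi> t x)) (at t)"
  using gen unfolding generates_def by blast

lemma orbit_derivative_0: "((\<lambda>s. snd (ch x) (\<Phi> s x)) has_vector_derivative f x) (at 0)"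
  using orbit_derivative[of 0 x] by (simp add: flow_0)

lemma tangent_map_field: "tangent_map A (\<Phi> t) x (f x) = f (\<Phi> t x)"
proof -
  have "((\<lambda>s. snd (ch (\<Phi> t x)) (\<Phi> t (\<Phi> s x))) has_vector_derivative tangent_map A (\<Phi> t) x (f x)) (at 0)"
    by (rule tangent_map_curve[OF flow_isCont_time flow_0 orbit_derivative_0])
  moreover have "((\<lambda>s. snd (ch (\<Phi> t x)) (\<Phi> t (\<Phi> s x))) has_vector_derivative f (\<Phi> t x)) (at 0)"
  proof -
    have "((\<lambda>s. snd (ch (\<Phi> t x)) (\<Phi> s x)) has_vector_derivative f (\<Phi> t x)) (at (t + 0))"
      using orbit_derivative[of t x] by simp
    moreover have "((\<lambda>s. t + s) has_vector_derivative 1) (at 0)"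
      by (auto intro!: derivative_eq_intros)
    ultimately have "((\<lambda>s. snd (ch (\<Phi> t x)) (\<Phi> s x)) \<circ> (\<lambda>s. t + s) has_vector_derivative 1 *\<^sub>R f (\<Phi> t x)) (at 0)"
      by (intro vector_diff_chain_at)
    then show ?thesis by (simp only: o_def flow_add scaleR_one)
  qed
  ultimately show ?thesis by (rule vector_derivative_unique_at)
qed

text \<open>The tangent map is injective and carries the field to itself.\<close>

lemma field_nonzero: "f x \<noteq> 0 \<Longrightarrow> f (\<Phi> t x) \<noteq> 0"
  using tangent_map_nonzero[of "f x" t x] by (simp add: tangent_map_field)

text \<open>A curve with nonzero velocity leaves its starting point.\<close>

lemma no_short_return:
  assumes "f x \<noteq> 0"
  obtains \<epsilon> where "\<epsilon> > 0" "\<And>s. s \<noteq> 0 \<Longrightarrow> \<bar>s\<bar> < \<epsilon> \<Longrightarrow> \<Phi> s x \<noteq> x"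
proof -
  have "((\<lambda>s. snd (ch x) (\<Phi> s x)) has_derivative (\<lambda>s. s *\<^sub>R f x)) (at 0)"
    using orbit_derivative_0 unfolding has_vector_derivative_def .
  moreover have "norm (f x) / 2 > 0" using assms by simp
  ultimately have "\<exists>d>0. \<forall>s. norm (s - 0) < d \<longrightarrow>
      norm (snd (ch x) (\<Phi> s x) - snd (ch x) (\<Phi> 0 x) - (s - 0) *\<^sub>R f x) \<le> norm (f x) / 2 * norm (s - 0)"
    unfolding has_derivative_at_alt by blast
  then obtain d where d: "d > 0" "\<And>s. \<bar>s\<bar> < d \<Longrightarrow>
      norm (snd (ch x) (\<Phi> s x) - snd (ch x) (\<Phi> 0 x) - s *\<^sub>R f x) \<le> norm (f x) / 2 * \<bar>s\<bar>"
    by auto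
  have "\<Phi> s x \<noteq> x" if "s \<noteq> 0" "\<bar>s\<bar> < d" for s
  proof
    assume "\<Phi> s x = x"
    then have "\<bar>s\<bar> * norm (f x) \<le> norm (f x) / 2 * \<bar>s\<bar>" using d(2)[OF that(2)] by (simp add: flow_0)
    then show False using assms that by (simp add: mult_le_cancel_left)
  qed
  then show ?thesis using that d(1) by blast
qed

end

section \<open>Tangent maps of a reparameterized flow\<close>

locale reparameterized_flow = generated_flow A m l \<phi> f + repar: C1_flow A m l \<psi>
  for A :: "('a::{t2_space, second_countable_topology}, 'n::finite) chart set"
    and m l \<phi> f \<psi> +
  fixes r :: "'a \<Rightarrow> real" and T :: "'a \<Rightarrow> real \<Rightarrow> real"
  assumes time_change: "orbit_time_change \<phi> \<psi> T"
    and speed: "\<And>x. f x \<noteq> 0 \<Longrightarrow> (T x has_real_derivative inverse (r x)) (at 0)"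
    and r_pos: "\<And>x. f x \<noteq> 0 \<Longrightarrow> 0 < r x"
begin

lemma T_simps: "T x 0 = 0" "strict_mono (T x)" "surj (T x)" "\<psi> \<tau> x = \<phi> (T x \<tau>) x"
  using time_change unfolding orbit_time_change_def by auto

lemma T_continuous: "continuous_on UNIV (T x)"
  using strict_mono_surj_continuous T_simps by blast

text \<open>On a closed orbit the relation between the flows determines \<open>T x \<tau>\<close> only up to periods. The difference
of the two sides is a continuous function of \<open>\<sigma>\<close> that vanishes at \<open>0\<close> and takes return times of \<open>x\<close> as values;
as \<open>0\<close> is an isolated return time, it vanishes identically.\<close>

lemma T_cocycle:
  assumes "f x \<noteq> 0"
  shows "T x (\<tau> + \<sigma>) = T x \<tau> + T (\<psi> \<tau> x) \<sigma>"
proof -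
  define h where "h \<sigma> = T x (\<tau> + \<sigma>) - T x \<tau> - T (\<psi> \<tau> x) \<sigma>" for \<sigma>
  have cont: "continuous_on UNIV h"
  proof -
    have "continuous_on UNIV (\<lambda>\<sigma>. T x (\<tau> + \<sigma>))"
      by (rule continuous_on_compose2[OF T_continuous[of x]]) (auto intro: continuous_intros)
    then show ?thesis unfolding h_def by (intro continuous_on_diff T_continuous continuous_on_const)
  qed
  have ret: "\<phi> (h \<sigma>) x = x" for \<sigma>
  proof -
    define a where "a = T x \<tau>"
    define b where "b = T (\<psi> \<tau> x) \<sigma>"
    define c where "c = T x (\<tau> + \<sigma>)"
    have "\<phi> c x = \<psi> (\<sigma> + \<tau>) x" unfolding c_def add.commute[of \<tau>] by (rule T_simps(4)[symmetric])
    also have "\<dots> = \<phi> b (\<phi> a x)" unfolding repar.flow_add a_def b_def T_simps(4)[of \<sigma>] unfolding T_simps(4)[of \<tau> x] ..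
    finally have eq: "\<phi> c x = \<phi> (b + a) x" unfolding flow_add .
    have "\<phi> (- (b + a) + c) x = \<phi> (- (b + a)) (\<phi> (b + a) x)" unfolding flow_add[of _ c] eq ..
    also have "\<dots> = \<phi> (- (b + a) + (b + a)) x" unfolding flow_add[of "- (b + a)" "b + a"] ..
    also have "\<dots> = x" by (simp add: flow_0)
    finally have "\<phi> (- (b + a) + c) x = x" .
    moreover have "h \<sigma> = - (b + a) + c" unfolding h_def a_def b_def c_def by simp
    ultimately show ?thesis by simp
  qed
  obtain \<epsilon> where \<epsilon>: "\<epsilon> > 0" "\<And>s. s \<noteq> 0 \<Longrightarrow> \<bar>s\<bar> < \<epsilon> \<Longrightarrow> \<phi> s x \<noteq> x"
    using no_short_return[OF assms] by blast
  have "h \<sigma> = 0"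
  proof (rule ccontr)
    assume nz: "h \<sigma> \<noteq> 0"
    define s where "s = min (\<epsilon> / 2) \<bar>h \<sigma>\<bar>"
    have conn: "connected (range (\<lambda>\<sigma>. \<bar>h \<sigma>\<bar>))"
      by (rule connected_continuous_image[OF continuous_on_rabs[OF cont] connected_UNIV])
    have "h 0 = 0" using T_simps(1) by (simp add: h_def)
    then have zero: "0 \<in> range (\<lambda>\<sigma>. \<bar>h \<sigma>\<bar>)" by (auto intro: image_eqI[of _ _ 0])
    have "0 \<le> s" "s \<le> \<bar>h \<sigma>\<bar>" unfolding s_def using \<epsilon>(1) by auto
    then have "s \<in> range (\<lambda>\<sigma>. \<bar>h \<sigma>\<bar>)"
      using connectedD_interval[OF conn zero rangeI[of _ \<sigma>]] by blast
    then obtain \<sigma>' where \<sigma>': "\<bar>h \<sigma>'\<bar> = s" by auto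
    have "0 < s" "s < \<epsilon>" unfolding s_def using \<epsilon>(1) nz by auto
    then show False using \<epsilon>(2)[of "h \<sigma>'"] ret[of \<sigma>'] \<sigma>' by auto
  qed
  then show ?thesis unfolding h_def by simp
qed

lemma T_derivative:
  assumes "f x \<noteq> 0"
  shows "(T x has_real_derivative inverse (r (\<psi> \<tau> x))) (at \<tau>)"
proof -
  have nz: "f (\<psi> \<tau> x) \<noteq> 0" using field_nonzero[OF assms] T_simps(4) by simp
  have "((\<lambda>s. T x \<tau> + T (\<psi> \<tau> x) (s - \<tau>)) has_real_derivative inverse (r (\<psi> \<tau> x))) (at \<tau>)"
    using speed[OF nz] by (auto intro!: derivative_eq_intros DERIV_chain2[where g = "\<lambda>s. s - \<tau>"])
  moreover have "(\<lambda>s. T x \<tau> + T (\<psi> \<tau> x) (s - \<tau>)) = T x"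
  proof
    fix s
    have "T x (\<tau> + (s - \<tau>)) = T x \<tau> + T (\<psi> \<tau> x) (s - \<tau>)" by (rule T_cocycle[OF assms])
    moreover have "\<tau> + (s - \<tau>) = s" by simp
    ultimately show "T x \<tau> + T (\<psi> \<tau> x) (s - \<tau>) = T x s" by metis
  qed
  ultimately show ?thesis by simp
qed

text \<open>By the intermediate value theorem, if \<open>T y\<close> ended up far from \<open>T x\<close> on \<open>{0..\<tau>}\<close>, the two would at some time
differ by exactly \<open>d\<close>, while every nonzero return time of \<open>x\<close> exceeds \<open>d\<close> in absolute value. For \<open>y = x\<close> this contradicts the
definition of \<open>T\<close>, and by compactness of \<open>{0..\<tau>}\<close> it remains contradictory for all \<open>y\<close> near \<open>x\<close>.\<close>

lemma T_tendsto:
  assumes x: "f x \<noteq> 0" and \<tau>: "0 \<le> \<tau>"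
  shows "((\<lambda>y. T y \<tau>) \<longlongrightarrow> T x \<tau>) (nhds x)"
proof (rule tendstoI)
  fix e :: real assume e: "0 < e"
  obtain \<epsilon> where \<epsilon>: "\<epsilon> > 0" "\<And>s. s \<noteq> 0 \<Longrightarrow> \<bar>s\<bar> < \<epsilon> \<Longrightarrow> \<phi> s x \<noteq> x"
    using no_short_return[OF x] by blast
  define d where "d = min e (\<epsilon> / 2)"
  have d: "0 < d" "d < \<epsilon>" "d \<le> e" unfolding d_def using e \<epsilon>(1) by auto
  have neq: "\<phi> (T x \<sigma> + s) x \<noteq> \<psi> \<sigma> x" if "s = d \<or> s = - d" for \<sigma> s
  proof
    assume "\<phi> (T x \<sigma> + s) x = \<psi> \<sigma> x"
    then have "\<phi> (- T x \<sigma>) (\<phi> (T x \<sigma> + s) x) = \<phi> (- T x \<sigma>) (\<phi> (T x \<sigma>) x)"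
      unfolding T_simps(4) by (rule arg_cong)
    then have "\<phi> (- T x \<sigma> + (T x \<sigma> + s)) x = \<phi> (- T x \<sigma> + T x \<sigma>) x"
      unfolding flow_add[of "- T x \<sigma>"] .
    then have "\<phi> s x = x" by (simp add: flow_0)
    moreover have "s \<noteq> 0" "\<bar>s\<bar> < \<epsilon>" using that d by auto
    ultimately show False using \<epsilon>(2) by blast
  qed
  have op: "open {(y, \<sigma>). \<phi> (T x \<sigma> + s) y \<noteq> \<psi> \<sigma> y}" for s
  proof -
    have "continuous_on UNIV (\<lambda>p::'a \<times> real. T x (snd p))"
      by (rule continuous_on_compose2[OF T_continuous[of x] continuous_on_snd[OF continuous_on_id]]) simp
    then have "continuous_on UNIV (\<lambda>p::'a \<times> real. (T x (snd p) + s, fst p))"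
      by (intro continuous_on_Pair continuous_on_add continuous_on_fst continuous_on_id continuous_on_const)
    then have "continuous_on UNIV (\<lambda>p. (\<lambda>(t, x). \<phi> t x) (T x (snd p) + s, fst p))"
      by (rule continuous_on_compose2[OF flow_continuous]) simp
    moreover have "continuous_on UNIV (\<lambda>p. (\<lambda>(t, x). \<psi> t x) (snd p, fst p))"
      by (rule continuous_on_compose2[OF repar.flow_continuous _ subset_UNIV])
        (intro continuous_on_Pair continuous_on_snd continuous_on_fst continuous_on_id)
    ultimately have "open {p. (\<lambda>(t, x). \<phi> t x) (T x (snd p) + s, fst p) \<noteq> (\<lambda>(t, x). \<psi> t x) (snd p, fst p)}"
      by (rule open_Collect_neq)
    then show ?thesis by (simp add: case_prod_beta')
  qed
  define N where "N s = {(y, \<sigma>). \<phi> (T x \<sigma> + s) y \<noteq> \<psi> \<sigma> y}" for s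
  have "open (N d \<inter> N (- d))" unfolding N_def by (intro open_Int op)
  moreover have "{x} \<times> {0..\<tau>} \<subseteq> N d \<inter> N (- d)"
  proof
    fix p assume "p \<in> {x} \<times> {0..\<tau>}"
    then have "p = (x, snd p)" by auto
    moreover have "(x, \<sigma>) \<in> N d \<inter> N (- d)" for \<sigma>
      unfolding N_def using neq[of d \<sigma>] neq[of "- d" \<sigma>] by simp
    ultimately show "p \<in> N d \<inter> N (- d)" by metis
  qed
  ultimately obtain X where X: "x \<in> X" "open X" and sub: "X \<times> {0..\<tau>} \<subseteq> N d \<inter> N (- d)"
    using Elementary_Topology.tube_lemma[where K = "{0..\<tau>}" and W = "N d \<inter> N (- d)" and ?x0.0 = x, OF compact_Icc] by metis
  have X3: "\<phi> (T x \<sigma> + s) y \<noteq> \<psi> \<sigma> y" if "y \<in> X" "0 \<le> \<sigma>" "\<sigma> \<le> \<tau>" "s = d \<or> s = - d" for y \<sigma> s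
  proof -
    have "(y, \<sigma>) \<in> N d \<inter> N (- d)" using that(1-3) by (intro subsetD[OF sub]) simp
    then have "(y, \<sigma>) \<in> N s" using that(4) by blast
    then show ?thesis unfolding N_def by simp
  qed
  have "\<bar>T y \<tau> - T x \<tau>\<bar> < d" if y: "y \<in> X" for y
  proof (rule ccontr)
    assume "\<not> \<bar>T y \<tau> - T x \<tau>\<bar> < d"
    moreover have "continuous_on {0..\<tau>} (\<lambda>\<sigma>. \<bar>T y \<sigma> - T x \<sigma>\<bar>)"
      by (intro continuous_intros continuous_on_subset[OF T_continuous]) auto
    moreover have "\<bar>T y 0 - T x 0\<bar> \<le> d" unfolding T_simps(1) using d(1) by simp
    ultimately obtain \<sigma> where \<sigma>: "0 \<le> \<sigma>" "\<sigma> \<le> \<tau>" "\<bar>T y \<sigma> - T x \<sigma>\<bar> = d"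
      using IVT'[of "\<lambda>\<sigma>. \<bar>T y \<sigma> - T x \<sigma>\<bar>" 0 d \<tau>] \<tau> unfolding not_less by blast
    then have "T y \<sigma> - T x \<sigma> = d \<or> T y \<sigma> - T x \<sigma> = - d" by linarith
    from X3[OF y \<sigma>(1,2) this] show False using T_simps(4)[of \<sigma> y] by simp
  qed
  then have "\<forall>y\<in>X. dist (T y \<tau>) (T x \<tau>) < e" using d(3) by (force simp: dist_real_def)
  then show "eventually (\<lambda>y. dist (T y \<tau>) (T x \<tau>) < e) (nhds x)"
    using X(1,2) unfolding eventually_nhds by blast
qed

lemma repar_orbit_derivative:
  assumes "f x \<noteq> 0"
  shows "((\<lambda>\<sigma>. snd (ch x) (\<psi> \<sigma> x)) has_vector_derivative (1 / r x) *\<^sub>R f x) (at 0)"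
proof -
  have "((\<lambda>s. snd (ch x) (\<phi> s x)) has_vector_derivative f x) (at (T x 0))"
    using orbit_derivative_0 T_simps(1) by simp
  then have "((\<lambda>s. snd (ch x) (\<phi> s x)) \<circ> T x has_vector_derivative inverse (r x) *\<^sub>R f x) (at 0)"
    by (rule vector_diff_chain_at[rotated]) (use speed[OF assms] in \<open>simp add: has_real_derivative_iff_has_vector_derivative\<close>)
  then show ?thesis by (simp add: o_def divide_inverse flip: T_simps(4))
qed

text \<open>The flow \<open>\<psi>\<close> is generated by \<open>f / r\<close> along the orbit, and the tangent maps of a flow preserve its generator.\<close>

lemma repar_tangent_map_field:
  assumes "f x \<noteq> 0"
  shows "tangent_map A (\<psi> \<tau>) x (f x) = (r x / r (\<psi> \<tau> x)) *\<^sub>R f (\<psi> \<tau> x)"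
proof -
  have nz: "f (\<psi> \<tau> x) \<noteq> 0" using field_nonzero[OF assms] T_simps(4) by simp
  have d: "((\<lambda>\<sigma>. snd (ch (\<psi> \<tau> x)) (\<psi> \<tau> (\<psi> \<sigma> x))) has_vector_derivative
      tangent_map A (\<psi> \<tau>) x ((1 / r x) *\<^sub>R f x)) (at 0)"
    by (rule repar.tangent_map_curve[OF repar.flow_isCont_time repar.flow_0 repar_orbit_derivative[OF assms]])
  have comm: "\<psi> \<tau> (\<psi> \<sigma> x) = \<psi> \<sigma> (\<psi> \<tau> x)" for \<sigma>
    unfolding repar.flow_add[symmetric] add.commute[of \<tau>] ..
  have "((\<lambda>\<sigma>. snd (ch (\<psi> \<tau> x)) (\<psi> \<sigma> (\<psi> \<tau> x))) has_vector_derivative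
      tangent_map A (\<psi> \<tau>) x ((1 / r x) *\<^sub>R f x)) (at 0)"
    using d unfolding comm .
  then have "tangent_map A (\<psi> \<tau>) x ((1 / r x) *\<^sub>R f x) = (1 / r (\<psi> \<tau> x)) *\<^sub>R f (\<psi> \<tau> x)"
    using repar_orbit_derivative[OF nz] by (rule vector_derivative_unique_at)
  then have "r x *\<^sub>R (1 / r x) *\<^sub>R tangent_map A (\<psi> \<tau>) x (f x) = r x *\<^sub>R (1 / r (\<psi> \<tau> x)) *\<^sub>R f (\<psi> \<tau> x)"
    by (simp add: linear_cmul[OF repar.tangent_map_linear])
  then show ?thesis using r_pos[OF assms] by simp
qed

lemma repar_tangent_map_diff:
  assumes x: "f x \<noteq> 0" and \<tau>: "0 \<le> \<tau>"
  shows "tangent_map A (\<psi> \<tau>) x v - tangent_map A (\<phi> (T x \<tau>)) x v \<in> span {f (\<psi> \<tau> x)}"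
proof -
  define t where "t = T x \<tau>"
  define z where "z = \<phi> t x"
  have z: "\<psi> \<tau> x = z" unfolding z_def t_def using T_simps(4) .
  define y0 where "y0 = snd (ch x) x"
  define W where "W = frechet_derivative (local_flow t x) (at (t, y0))"
  have W: "(local_flow t x has_derivative W) (at (t, y0))"
    unfolding W_def y0_def by (rule local_flow_has_derivative)
  have Wv: "W (0, v) = tangent_map A (\<phi> t) x v"
    unfolding W_def y0_def using tangent_map_eq_partial(2) by simp
  have Wt: "W (1, 0) = f z"
  proof -
    have "((\<lambda>s. (s, y0)) has_derivative (\<lambda>s. (s, 0))) (at t)" by (auto intro!: derivative_eq_intros)
    from diff_chain_at[OF this W]
    have "(local_flow t x \<circ> (\<lambda>s. (s, y0)) has_derivative (\<lambda>s. W (s, 0))) (at t)"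
      by (simp only: o_def)
    moreover have "(\<lambda>s. W (s, 0)) = (\<lambda>s. s *\<^sub>R W (1, 0))"
    proof
      fix s
      have "(s, 0) = s *\<^sub>R (1, 0 :: real ^ 'n)" by simp
      then show "W (s, 0) = s *\<^sub>R W (1, 0)"
        using linear_cmul[OF has_derivative_linear[OF W], of s "(1, 0)"] by (simp only:)
    qed
    ultimately have "(local_flow t x \<circ> (\<lambda>s. (s, y0)) has_vector_derivative W (1, 0)) (at t)"
      unfolding has_vector_derivative_def by (simp only:)
    moreover have "local_flow t x \<circ> (\<lambda>s. (s, y0)) = (\<lambda>s. snd (ch z) (\<phi> s x))"
      by (auto simp: local_flow_def y0_def z_def ch_simps)
    ultimately have "((\<lambda>s. snd (ch z) (\<phi> s x)) has_vector_derivative W (1, 0)) (at t)" by (simp only:)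
    then show ?thesis
      using orbit_derivative[of t x] unfolding z_def by (rule vector_derivative_unique_at)
  qed
  have c: "((\<lambda>y. chart_inv (ch x) y) \<longlongrightarrow> x) (at y0)"
  proof -
    have "isCont (chart_inv (ch x)) y0"
      using ch_simps(1,3,5)[of x] unfolding y0_def by (metis continuous_on_eq_continuous_at imageI)
    then show ?thesis unfolding isCont_def y0_def by (simp add: ch_simps)
  qed
  have "(snd (ch z) \<circ> \<psi> \<tau> \<circ> chart_inv (ch x) has_derivative tangent_map A (\<psi> \<tau>) x) (at y0)"
    using repar.tangent_map_eq_partial(1)[of \<tau> x] unfolding z y0_def .
  moreover have "((\<lambda>y. T (chart_inv (ch x) y) \<tau>) \<longlongrightarrow> t) (at y0)"
    unfolding t_def by (rule filterlim_compose[OF T_tendsto[OF x \<tau>] c])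
  ultimately have "tangent_map A (\<psi> \<tau>) x v - W (0, v) \<in> span {W (1, 0)}"
  proof (rule derivative_difference_in_time_direction[OF W])
    show "(snd (ch z) \<circ> \<psi> \<tau> \<circ> chart_inv (ch x)) y0 = local_flow t x (t, y0)"
      using z by (simp add: local_flow_def y0_def z_def ch_simps)
    show "eventually (\<lambda>y. (snd (ch z) \<circ> \<psi> \<tau> \<circ> chart_inv (ch x)) y
        = local_flow t x (T (chart_inv (ch x) y) \<tau>, y)) (at y0)"
      using T_simps(4) by (auto simp: local_flow_def z_def)
    show "W (1, 0) \<noteq> 0" using Wt field_nonzero[OF x] z_def by simp
  qed
  then show ?thesis unfolding Wv Wt t_def z .
qed

end

section \<open>Elapsed time along one orbit\<close>

locale reparameterized_orbit = reparameterized_flow A m l \<phi> f \<psi> r T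
  for A :: "('a::{t2_space, second_countable_topology}, 'n::finite) chart set"
    and m l \<phi> f \<psi> r T +
  fixes g :: "'a \<Rightarrow> real ^ 'n \<Rightarrow> real ^ 'n \<Rightarrow> real" and x :: 'a and R :: real
  assumes g: "\<And>y. inner_form (g y)" and x: "f x \<noteq> 0"
    and avg: "(orbit_average \<phi> r x \<longlongrightarrow> R) at_top" and R: "0 < R"
begin

text \<open>The time shown by the clock of \<open>\<psi>\<close> when \<open>\<phi>\<close> has moved \<open>x\<close> for time \<open>t\<close>.\<close>

definition \<theta> :: "real \<Rightarrow> real" where "\<theta> = inv (T x)"

lemma \<theta>_T: "\<theta> (T x \<tau>) = \<tau>"
  unfolding \<theta>_def by (rule inv_f_f[OF strict_mono_imp_inj_on[OF T_simps(2)]])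

lemma T_\<theta>: "T x (\<theta> t) = t"
  unfolding \<theta>_def by (rule surj_f_inv_f[OF T_simps(3)])

lemma \<theta>_0: "\<theta> 0 = 0"
  using \<theta>_T[of 0] unfolding T_simps(1) .

lemma \<theta>_strict_mono: "strict_mono \<theta>"
proof (rule strict_monoI)
  fix a b :: real assume "a < b"
  then have "T x (\<theta> a) < T x (\<theta> b)" unfolding T_\<theta> .
  then show "\<theta> a < \<theta> b" using strict_mono_less[OF T_simps(2)] by blast
qed

lemma \<theta>_surj: "surj \<theta>"
  by (rule surjI[of _ "T x"]) (rule \<theta>_T)

lemma \<theta>_at_top: "filterlim \<theta> at_top at_top"
  by (rule strict_mono_surj_at_top[OF \<theta>_strict_mono \<theta>_surj])

lemma T_at_top: "filterlim (T x) at_top at_top"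
  by (rule strict_mono_surj_at_top[OF T_simps(2,3)])

lemma \<theta>_derivative: "(\<theta> has_real_derivative r (\<phi> t x)) (at t)"
proof -
  have eq: "\<psi> (\<theta> t) x = \<phi> t x" unfolding T_simps(4) T_\<theta> ..
  have "(\<theta> has_real_derivative inverse (inverse (r (\<phi> t x)))) (at t)"
  proof (rule DERIV_inverse_function)
    show "(T x has_real_derivative inverse (r (\<phi> t x))) (at (\<theta> t))"
      using T_derivative[OF x, of "\<theta> t"] unfolding eq .
    show "inverse (r (\<phi> t x)) \<noteq> 0" using r_pos[OF field_nonzero[OF x], of t] by simp
    show "t - 1 < t" "t < t + 1" by auto
    show "isCont \<theta> t"
      using strict_mono_surj_continuous[OF \<theta>_strict_mono \<theta>_surj] by (simp add: continuous_on_eq_continuous_at)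
  qed (rule T_\<theta>)
  then show ?thesis by simp
qed

lemma \<theta>_average: "((\<lambda>t. \<theta> t / t) \<longlongrightarrow> R) at_top"
proof -
  have "eventually (\<lambda>t. orbit_average \<phi> r x t = \<theta> t / t) at_top"
  proof (rule eventually_at_top_linorderI[of 0])
    fix t :: real assume t: "0 \<le> t"
    have "((\<lambda>s. r (\<phi> s x)) has_integral \<theta> t - \<theta> 0) {0..t}"
      by (rule fundamental_theorem_of_calculus[OF t], rule has_vector_derivative_at_within,
          rule \<theta>_derivative[unfolded has_real_derivative_iff_has_vector_derivative])
    then have "integral {0..t} (\<lambda>s. r (\<phi> s x)) = \<theta> t"
      unfolding \<theta>_0 diff_zero by (rule integral_unique)
    then show "orbit_average \<phi> r x t = \<theta> t / t" unfolding orbit_average_def by (simp only: divide_inverse mult_1 mult.commute)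
  qed
  from tendsto_cong[OF this] avg show ?thesis by (simp only:)
qed

lemma T_rate: "((\<lambda>\<tau>. T x \<tau> / \<tau>) \<longlongrightarrow> 1 / R) at_top"
proof -
  have "((\<lambda>\<tau>. \<theta> (T x \<tau>) / T x \<tau>) \<longlongrightarrow> R) at_top"
    by (rule filterlim_compose[OF \<theta>_average T_at_top])
  then have "((\<lambda>\<tau>. \<tau> / T x \<tau>) \<longlongrightarrow> R) at_top" unfolding \<theta>_T .
  from tendsto_divide[OF tendsto_const[of 1] this] show ?thesis using R by simp
qed

lemma time_changed_rate:
  assumes "((\<lambda>t. 1 / t * h t) \<longlongrightarrow> c) at_top"
  shows "((\<lambda>\<tau>. 1 / \<tau> * h (T x \<tau>)) \<longlongrightarrow> c / R) at_top"
proof -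
  have "((\<lambda>\<tau>. (1 / T x \<tau> * h (T x \<tau>)) * (T x \<tau> / \<tau>)) \<longlongrightarrow> c * (1 / R)) at_top"
    by (rule tendsto_mult[OF filterlim_compose[OF assms T_at_top] T_rate])
  moreover have "eventually (\<lambda>\<tau>. (1 / T x \<tau> * h (T x \<tau>)) * (T x \<tau> / \<tau>) = 1 / \<tau> * h (T x \<tau>)) at_top"
    using filterlim_at_top_dense[THEN iffD1, OF T_at_top, rule_format, of 0] by eventually_elim simp
  ultimately have "((\<lambda>\<tau>. 1 / \<tau> * h (T x \<tau>)) \<longlongrightarrow> c * (1 / R)) at_top"
    by (rule Lim_transform_eventually)
  then show ?thesis unfolding times_divide_eq_right mult_1_right[of c] .
qed

lemma log_r_rate_zero:
  assumes "((\<lambda>\<tau>. 1 / \<tau> * ln (r (\<psi> \<tau> x))) \<longlongrightarrow> \<kappa>) at_top"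
  shows "\<kappa> = 0"
proof -
  have "((\<lambda>t. 1 / \<theta> t * ln (r (\<psi> (\<theta> t) x))) \<longlongrightarrow> \<kappa>) at_top"
    by (rule filterlim_compose[OF assms \<theta>_at_top])
  then have "((\<lambda>t. (1 / \<theta> t * ln (r (\<phi> t x))) * (\<theta> t / t)) \<longlongrightarrow> \<kappa> * R) at_top"
    unfolding T_simps(4) T_\<theta> by (rule tendsto_mult[OF _ \<theta>_average])
  moreover have "eventually (\<lambda>t. (1 / \<theta> t * ln (r (\<phi> t x))) * (\<theta> t / t) = ln (r (\<phi> t x)) / t) at_top"
    using filterlim_at_top_dense[THEN iffD1, OF \<theta>_at_top, rule_format, of 0] by eventually_elim simp
  ultimately have "((\<lambda>t. ln (r (\<phi> t x)) / t) \<longlongrightarrow> \<kappa> * R) at_top" by (rule Lim_transform_eventually)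
  then have "\<kappa> * R = 0"
    using exponential_rate_of_speed_zero[OF \<theta>_derivative r_pos[OF field_nonzero[OF x]] \<theta>_average R] by blast
  then show ?thesis using R by simp
qed

end

section \<open>Growth rates under the reparameterized flow\<close>

text \<open>The frame is indexed by the coordinates of \<open>real ^ 'n\<close>, as determinants require. The vector \<open>e j\<close> is a multiple
of \<open>f x\<close> rather than \<open>f x\<close> itself, so that any basis adapted to the splitting can be used.\<close>

locale adapted_frame = reparameterized_orbit A m l \<phi> f \<psi> r T g x R
  for A :: "('a::{t2_space, second_countable_topology}, 'n::finite) chart set"
    and m l \<phi> f \<psi> r T g x R +
  fixes e :: "'n \<Rightarrow> real ^ 'n" and \<Lambda> :: "'n \<Rightarrow> real" and j :: 'n and b :: real
  assumes frame: "det (\<chi> i. e i) \<noteq> 0" and e_j: "e j = b *\<^sub>R f x"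
    and exponent: "\<And>i. ((\<lambda>t. 1 / t * ln (tnorm g (\<phi> t x) (tangent_map A (\<phi> t) x (e i)))) \<longlongrightarrow> \<Lambda> i) at_top"
    and volume: "((\<lambda>t. 1 / t * ln (jacobian A g (\<phi> t) x)) \<longlongrightarrow> (\<Sum>i\<in>UNIV. \<Lambda> i)) at_top"
    and neutral: "\<Lambda> j = 0"
begin

abbreviation "D\<phi> \<tau> \<equiv> tangent_map A (\<phi> (T x \<tau>)) x"
abbreviation "D\<psi> \<tau> \<equiv> tangent_map A (\<psi> \<tau>) x"

lemma e_nonzero: "e i \<noteq> 0"
proof
  assume "e i = 0"
  then have "row i (\<chi> i. e i) = 0" by (simp add: row_def vec_eq_iff)
  then show False using det_zero_row frame by blast
qed

lemma b_nonzero: "b \<noteq> 0"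
  using e_j e_nonzero[of j] by auto

lemma gram_frame_pos: "0 < gram (g x) e"
  unfolding gram_eq_det_squared[OF inner_form_simps(1)[OF g], of _ e]
  by (rule mult_pos_pos[OF gram_axis_pos[OF g]]) (use frame in simp)

lemma jacobian_flow:
  "0 < jacobian A g (\<phi> t) x"
  "gram (g (\<phi> t x)) (\<lambda>i. tangent_map A (\<phi> t) x (e i)) = (jacobian A g (\<phi> t) x)\<^sup>2 * gram (g x) e"
  by (rule jacobian_gram[OF g tangent_map_linear]; erule tangent_map_nonzero)+

lemma jacobian_repar:
  "0 < jacobian A g (\<psi> t) x"
  "gram (g (\<psi> t x)) (\<lambda>i. tangent_map A (\<psi> t) x (e i)) = (jacobian A g (\<psi> t) x)\<^sup>2 * gram (g x) e"
  by (rule jacobian_gram[OF g repar.tangent_map_linear]; erule repar.tangent_map_nonzero)+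

lemma r_orbit_pos: "0 < r (\<psi> \<tau> x)"
  unfolding T_simps(4) by (rule r_pos[OF field_nonzero[OF x]])

lemma span_frame_j: "span {D\<phi> \<tau> (e j)} = span {f (\<psi> \<tau> x)}"
proof -
  have "D\<phi> \<tau> (e j) = b *\<^sub>R f (\<psi> \<tau> x)"
    unfolding e_j linear_cmul[OF tangent_map_linear] tangent_map_field T_simps(4) ..
  then show ?thesis using b_nonzero by (simp add: span_image_scale[of "{f (\<psi> \<tau> x)}" "\<lambda>_. b", simplified])
qed

lemma D\<psi>_field: "D\<psi> \<tau> (e j) = (r x / r (\<psi> \<tau> x)) *\<^sub>R D\<phi> \<tau> (e j)"
  unfolding e_j linear_cmul[OF tangent_map_linear] linear_cmul[OF repar.tangent_map_linear]
    tangent_map_field repar_tangent_map_field[OF x] T_simps(4)[symmetric]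
  by (simp only: scaleR_scaleR mult.commute)

text \<open>Relative to the frame \<open>D\<phi> \<tau> (e i)\<close>, the frame \<open>D\<psi> \<tau> (e i)\<close> is sheared along its \<open>j\<close>-th vector, which
in addition is rescaled.\<close>

lemma jacobian_ratio:
  assumes \<tau>: "0 \<le> \<tau>"
  shows "jacobian A g (\<psi> \<tau>) x = r x / r (\<psi> \<tau> x) * jacobian A g (\<phi> (T x \<tau>)) x"
proof -
  define c where "c = r x / r (\<psi> \<tau> x)"
  define K where "K = gram (g (\<psi> \<tau> x)) (\<lambda>i. axis i 1)"
  have c: "0 < c" unfolding c_def using r_orbit_pos r_pos[OF x] by simp
  have gr: "gram (g (\<psi> \<tau> x)) v = K * (det (\<chi> i. v i))\<^sup>2" for v
    unfolding K_def by (rule gram_eq_det_squared[OF inner_form_simps(1)[OF g]])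
  have "det (\<chi> i. D\<psi> \<tau> (e i)) = c * det (\<chi> i. D\<phi> \<tau> (e i))"
  proof (rule det_shear_rows[where j = j])
    show "c \<noteq> 0" using c by simp
    show "D\<psi> \<tau> (e j) = c *\<^sub>R D\<phi> \<tau> (e j)" unfolding c_def by (rule D\<psi>_field)
    show "D\<psi> \<tau> (e i) - D\<phi> \<tau> (e i) \<in> span {D\<phi> \<tau> (e j)}" for i
      unfolding span_frame_j by (rule repar_tangent_map_diff[OF x \<tau>])
  qed
  then have "gram (g (\<psi> \<tau> x)) (\<lambda>i. D\<psi> \<tau> (e i)) = c\<^sup>2 * gram (g (\<psi> \<tau> x)) (\<lambda>i. D\<phi> \<tau> (e i))"
    unfolding gr by (simp only: power_mult_distrib mult.left_commute)
  moreover have "gram (g (\<psi> \<tau> x)) (\<lambda>i. D\<phi> \<tau> (e i)) = (jacobian A g (\<phi> (T x \<tau>)) x)\<^sup>2 * gram (g x) e"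
    using jacobian_flow(2)[of "T x \<tau>"] unfolding T_simps(4)[symmetric] .
  ultimately have "(jacobian A g (\<psi> \<tau>) x)\<^sup>2 * gram (g x) e
      = (c * jacobian A g (\<phi> (T x \<tau>)) x)\<^sup>2 * gram (g x) e"
    unfolding jacobian_repar(2) by (simp only: power_mult_distrib mult.assoc)
  then have "(jacobian A g (\<psi> \<tau>) x)\<^sup>2 = (c * jacobian A g (\<phi> (T x \<tau>)) x)\<^sup>2"
    using gram_frame_pos by simp
  then show ?thesis
    unfolding c_def[symmetric] power2_eq_iff
    using jacobian_repar(1)[of \<tau>] mult_pos_pos[OF c jacobian_flow(1)[of "T x \<tau>"]] by linarith
qed

lemma volume_time_changed:
  "((\<lambda>\<tau>. 1 / \<tau> * ln (jacobian A g (\<phi> (T x \<tau>)) x)) \<longlongrightarrow> (\<Sum>i\<in>UNIV. \<Lambda> i) / R) at_top"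
  by (rule time_changed_rate[OF volume])

lemma exponent_time_changed:
  "((\<lambda>\<tau>. 1 / \<tau> * ln (tnorm g (\<psi> \<tau> x) (D\<phi> \<tau> (e i)))) \<longlongrightarrow> \<Lambda> i / R) at_top"
  using time_changed_rate[OF exponent[of i]] unfolding T_simps(4)[symmetric] .

text \<open>The quotient of the two Jacobians expresses \<open>r (\<psi> \<tau> x)\<close> through quantities with known exponential rates; its own
rate exists therefore, and must be \<open>0\<close>.\<close>

lemma repar_volume:
  assumes "((\<lambda>\<tau>. 1 / \<tau> * ln (jacobian A g (\<psi> \<tau>) x)) \<longlongrightarrow> S) at_top"
  shows "S * R = (\<Sum>i\<in>UNIV. \<Lambda> i)"
    and "((\<lambda>\<tau>. 1 / \<tau> * ln (r (\<psi> \<tau> x))) \<longlongrightarrow> 0) at_top"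
proof -
  have "((\<lambda>\<tau>. 1 / \<tau> * ln (r x) + 1 / \<tau> * ln (jacobian A g (\<phi> (T x \<tau>)) x) - 1 / \<tau> * ln (jacobian A g (\<psi> \<tau>) x))
      \<longlongrightarrow> 0 + (\<Sum>i\<in>UNIV. \<Lambda> i) / R - S) at_top"
    by (intro tendsto_diff tendsto_add const_over_time volume_time_changed assms)
  moreover have "eventually (\<lambda>\<tau>. 1 / \<tau> * ln (r x) + 1 / \<tau> * ln (jacobian A g (\<phi> (T x \<tau>)) x)
      - 1 / \<tau> * ln (jacobian A g (\<psi> \<tau>) x) = 1 / \<tau> * ln (r (\<psi> \<tau> x))) at_top"
  proof (rule eventually_at_top_linorderI[of 0])
    fix \<tau> :: real assume \<tau>: "0 \<le> \<tau>"
    have *: "ln (jacobian A g (\<psi> \<tau>) x) = ln (r x) - ln (r (\<psi> \<tau> x)) + ln (jacobian A g (\<phi> (T x \<tau>)) x)"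
      unfolding jacobian_ratio[OF \<tau>]
      using r_pos[OF x] r_orbit_pos[of \<tau>] jacobian_flow(1)[of "T x \<tau>"]
      by (simp add: ln_mult_pos ln_div)
    show "1 / \<tau> * ln (r x) + 1 / \<tau> * ln (jacobian A g (\<phi> (T x \<tau>)) x)
      - 1 / \<tau> * ln (jacobian A g (\<psi> \<tau>) x) = 1 / \<tau> * ln (r (\<psi> \<tau> x))"
      unfolding * by (simp add: algebra_simps diff_divide_distrib add_divide_distrib)
  qed
  ultimately have lim: "((\<lambda>\<tau>. 1 / \<tau> * ln (r (\<psi> \<tau> x))) \<longlongrightarrow> 0 + (\<Sum>i\<in>UNIV. \<Lambda> i) / R - S) at_top"
    by (rule Lim_transform_eventually)
  then have z: "0 + (\<Sum>i\<in>UNIV. \<Lambda> i) / R - S = 0" by (rule log_r_rate_zero)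
  show "((\<lambda>\<tau>. 1 / \<tau> * ln (r (\<psi> \<tau> x))) \<longlongrightarrow> 0) at_top" using lim unfolding z .
  show "S * R = (\<Sum>i\<in>UNIV. \<Lambda> i)" using z R by (simp add: field_simps)
qed

lemma repar_exponent_flow_direction:
  assumes "((\<lambda>\<tau>. 1 / \<tau> * ln (jacobian A g (\<psi> \<tau>) x)) \<longlongrightarrow> S) at_top"
  shows "((\<lambda>\<tau>. 1 / \<tau> * ln (tnorm g (\<psi> \<tau> x) (D\<psi> \<tau> (e j)))) \<longlongrightarrow> 0) at_top"
proof -
  have "((\<lambda>\<tau>. 1 / \<tau> * ln (r x) - 1 / \<tau> * ln (r (\<psi> \<tau> x)) + 1 / \<tau> * ln (tnorm g (\<psi> \<tau> x) (D\<phi> \<tau> (e j))))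
      \<longlongrightarrow> 0 - 0 + \<Lambda> j / R) at_top"
    by (intro tendsto_diff tendsto_add const_over_time repar_volume(2)[OF assms] exponent_time_changed)
  moreover have "1 / \<tau> * ln (r x) - 1 / \<tau> * ln (r (\<psi> \<tau> x)) + 1 / \<tau> * ln (tnorm g (\<psi> \<tau> x) (D\<phi> \<tau> (e j)))
      = 1 / \<tau> * ln (tnorm g (\<psi> \<tau> x) (D\<psi> \<tau> (e j)))" for \<tau>
  proof -
    have p: "0 < tnorm g (\<psi> \<tau> x) (D\<phi> \<tau> (e j))"
      by (rule tnorm_simps(1)[OF g tangent_map_nonzero[OF e_nonzero]])
    have *: "ln (tnorm g (\<psi> \<tau> x) (D\<psi> \<tau> (e j))) = ln (r x) - ln (r (\<psi> \<tau> x)) + ln (tnorm g (\<psi> \<tau> x) (D\<phi> \<tau> (e j)))"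
      unfolding D\<psi>_field tnorm_simps(4)[OF g]
      using p r_pos[OF x] r_orbit_pos[of \<tau>] by (simp add: ln_mult_pos ln_div)
    show ?thesis unfolding * by (simp add: algebra_simps diff_divide_distrib add_divide_distrib)
  qed
  ultimately show ?thesis unfolding neutral by simp
qed

text \<open>The volume of the frame \<open>D\<phi> \<tau> (e i)\<close> with the \<open>k\<close>-th vector replaced by \<open>D\<psi> \<tau> v\<close> is \<open>\<bar>a k\<bar>\<close> times
that of the unchanged frame, because \<open>D\<psi> \<tau> v\<close> and \<open>D\<phi> \<tau> v\<close> differ by a multiple of the \<open>j\<close>-th vector and
\<open>k \<noteq> j\<close>. Dividing the volume by the lengths of the other vectors leaves the rate \<open>\<Lambda> k\<close> for the length of \<open>D\<psi> \<tau> v\<close>.\<close>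

lemma repar_exponent_lower_bound:
  assumes v: "v = (\<Sum>i\<in>UNIV. a i *\<^sub>R e i)" and k: "a k \<noteq> 0" "k \<noteq> j"
    and lim: "((\<lambda>\<tau>. 1 / \<tau> * ln (tnorm g (\<psi> \<tau> x) (D\<psi> \<tau> v))) \<longlongrightarrow> d) at_top"
  shows "\<Lambda> k \<le> d * R"
proof -
  define N where "N \<tau> w = tnorm g (\<psi> \<tau> x) w" for \<tau> w
  define C where "C = ln ((a k)\<^sup>2 * gram (g x) e) - ln (fact CARD('n))"
  have "v \<noteq> 0"
  proof
    assume "v = 0"
    then have "det (\<chi> i. if i = k then (\<Sum>m\<in>UNIV. a m *\<^sub>R e m) else e i) = 0"
      unfolding v[symmetric] by (intro det_zero_row[of k]) (simp add: row_def vec_eq_iff)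
    then show False unfolding det_replace_row using k(1) frame by simp
  qed
  have bound: "C + 2 * ln (jacobian A g (\<phi> (T x \<tau>)) x)
      \<le> 2 * ln (N \<tau> (D\<psi> \<tau> v)) + 2 * (\<Sum>i\<in>UNIV - {k}. ln (N \<tau> (D\<phi> \<tau> (e i))))" if \<tau>: "0 \<le> \<tau>" for \<tau>
  proof -
    define w where "w i = D\<phi> \<tau> (e i)" for i
    define u where "u i = (if i = k then D\<psi> \<tau> v else w i)" for i
    have "D\<psi> \<tau> v - D\<phi> \<tau> v \<in> span {w j}"
      unfolding w_def span_frame_j by (rule repar_tangent_map_diff[OF x \<tau>])
    then obtain q where "D\<psi> \<tau> v - D\<phi> \<tau> v = q *\<^sub>R w j" unfolding span_singleton by blast
    then have q: "D\<psi> \<tau> v = D\<phi> \<tau> v + q *\<^sub>R w j" by (simp add: algebra_simps)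
    have "D\<phi> \<tau> v = (\<Sum>i\<in>UNIV. a i *\<^sub>R w i)"
      unfolding v linear_sum[OF tangent_map_linear] linear_cmul[OF tangent_map_linear] w_def ..
    then have Dv: "D\<psi> \<tau> v = (\<Sum>i\<in>UNIV. (a i + (if i = j then q else 0)) *\<^sub>R w i)"
      unfolding q by (simp add: scaleR_left_distrib sum.distrib if_distrib[of "\<lambda>c. c *\<^sub>R _"] cong: if_cong)
    have "det (\<chi> i. u i) = (a k + (if k = j then q else 0)) * det (\<chi> i. w i)"
      unfolding u_def Dv by (rule det_replace_row)
    then have "det (\<chi> i. u i) = a k * det (\<chi> i. w i)" using k(2) by simp
    then have "gram (g (\<psi> \<tau> x)) u = (a k)\<^sup>2 * gram (g (\<psi> \<tau> x)) w"
      unfolding gram_eq_det_squared[OF inner_form_simps(1)[OF g], of _ u]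
        gram_eq_det_squared[OF inner_form_simps(1)[OF g], of _ w]
      by (simp add: power_mult_distrib)
    also have "gram (g (\<psi> \<tau> x)) w = (jacobian A g (\<phi> (T x \<tau>)) x)\<^sup>2 * gram (g x) e"
      using jacobian_flow(2)[of "T x \<tau>"] unfolding T_simps(4)[symmetric] w_def .
    finally have "(a k)\<^sup>2 * ((jacobian A g (\<phi> (T x \<tau>)) x)\<^sup>2 * gram (g x) e)
        \<le> fact CARD('n) * (\<Prod>i\<in>UNIV. g (\<psi> \<tau> x) (u i) (u i))"
      using gram_le_fact_prod[OF g, of "\<psi> \<tau> x" u] by simp
    also have "(\<Prod>i\<in>UNIV. g (\<psi> \<tau> x) (u i) (u i)) = (\<Prod>i\<in>UNIV. (N \<tau> (u i))\<^sup>2)"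
      unfolding N_def tnorm_simps(2)[OF g] ..
    also have "\<dots> = (N \<tau> (D\<psi> \<tau> v) * (\<Prod>i\<in>UNIV - {k}. N \<tau> (w i)))\<^sup>2"
      unfolding prod.remove[OF finite UNIV_I, of _ k] by (simp add: u_def power_mult_distrib prod_power_distrib)
    finally have le: "((a k)\<^sup>2 * gram (g x) e) * (jacobian A g (\<phi> (T x \<tau>)) x)\<^sup>2
        \<le> fact CARD('n) * (N \<tau> (D\<psi> \<tau> v) * (\<Prod>i\<in>UNIV - {k}. N \<tau> (w i)))\<^sup>2"
      by (simp only: mult_ac)
    have p1: "0 < N \<tau> (D\<psi> \<tau> v)"
      unfolding N_def by (rule tnorm_simps(1)[OF g repar.tangent_map_nonzero[OF \<open>v \<noteq> 0\<close>]])
    have p2: "0 < N \<tau> (w i)" for i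
      unfolding N_def w_def by (rule tnorm_simps(1)[OF g tangent_map_nonzero[OF e_nonzero]])
    have p3: "0 < (\<Prod>i\<in>UNIV - {k}. N \<tau> (w i))" using p2 by (intro prod_pos) auto
    have p4: "0 < (a k)\<^sup>2 * gram (g x) e" using k(1) gram_frame_pos by simp
    have lnp: "ln (\<Prod>i\<in>UNIV - {k}. N \<tau> (w i)) = (\<Sum>i\<in>UNIV - {k}. ln (N \<tau> (w i)))"
      using p2 by (intro ln_prod) (auto simp: less_imp_neq[symmetric])
    note p5 = jacobian_flow(1)[of "T x \<tau>"]
    have "ln ((a k)\<^sup>2 * gram (g x) e) + 2 * ln (jacobian A g (\<phi> (T x \<tau>)) x)
        = ln (((a k)\<^sup>2 * gram (g x) e) * (jacobian A g (\<phi> (T x \<tau>)) x)\<^sup>2)"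
      using p4 p5 by (simp only: ln_mult_pos zero_less_power ln_realpow)
    also have "\<dots> \<le> ln (fact CARD('n) * (N \<tau> (D\<psi> \<tau> v) * (\<Prod>i\<in>UNIV - {k}. N \<tau> (w i)))\<^sup>2)"
      by (rule ln_mono[OF le mult_pos_pos[OF p4 zero_less_power[OF p5]]])
    also have "\<dots> = ln (fact CARD('n)) + 2 * (ln (N \<tau> (D\<psi> \<tau> v)) + (\<Sum>i\<in>UNIV - {k}. ln (N \<tau> (w i))))"
      unfolding lnp[symmetric] using p1 p3 fact_gt_zero[of "CARD('n)", where 'a = real]
      by (simp only: ln_mult_pos zero_less_power ln_realpow mult_pos_pos)
    finally show ?thesis unfolding C_def w_def distrib_left by (simp only: diff_add_eq diff_le_eq ac_simps)
  qed
  have "((\<lambda>\<tau>. 1 / \<tau> * C + 2 * (1 / \<tau> * ln (jacobian A g (\<phi> (T x \<tau>)) x))) \<longlongrightarrow> 0 + 2 * ((\<Sum>i\<in>UNIV. \<Lambda> i) / R)) at_top"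
    by (intro tendsto_add tendsto_mult tendsto_const const_over_time volume_time_changed)
  moreover have "((\<lambda>\<tau>. 2 * (1 / \<tau> * ln (N \<tau> (D\<psi> \<tau> v))) + 2 * (\<Sum>i\<in>UNIV - {k}. 1 / \<tau> * ln (N \<tau> (D\<phi> \<tau> (e i)))))
      \<longlongrightarrow> 2 * d + 2 * (\<Sum>i\<in>UNIV - {k}. \<Lambda> i / R)) at_top"
    unfolding N_def by (intro tendsto_add tendsto_mult tendsto_const tendsto_sum lim exponent_time_changed)
  moreover have "eventually (\<lambda>\<tau>. 1 / \<tau> * C + 2 * (1 / \<tau> * ln (jacobian A g (\<phi> (T x \<tau>)) x))
      \<le> 2 * (1 / \<tau> * ln (N \<tau> (D\<psi> \<tau> v))) + 2 * (\<Sum>i\<in>UNIV - {k}. 1 / \<tau> * ln (N \<tau> (D\<phi> \<tau> (e i))))) at_top"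
  proof (rule eventually_at_top_linorderI[of 0])
    fix \<tau> :: real assume \<tau>: "0 \<le> \<tau>"
    have "1 / \<tau> * (C + 2 * ln (jacobian A g (\<phi> (T x \<tau>)) x))
      \<le> 1 / \<tau> * (2 * ln (N \<tau> (D\<psi> \<tau> v)) + 2 * (\<Sum>i\<in>UNIV - {k}. ln (N \<tau> (D\<phi> \<tau> (e i)))))"
      using \<tau> by (intro mult_left_mono bound) auto
    then show "1 / \<tau> * C + 2 * (1 / \<tau> * ln (jacobian A g (\<phi> (T x \<tau>)) x))
      \<le> 2 * (1 / \<tau> * ln (N \<tau> (D\<psi> \<tau> v))) + 2 * (\<Sum>i\<in>UNIV - {k}. 1 / \<tau> * ln (N \<tau> (D\<phi> \<tau> (e i))))"
      unfolding sum_distrib_left[symmetric] by (simp only: distrib_left mult.left_commute)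
  qed
  ultimately have "0 + 2 * ((\<Sum>i\<in>UNIV. \<Lambda> i) / R) \<le> 2 * d + 2 * (\<Sum>i\<in>UNIV - {k}. \<Lambda> i / R)"
    using tendsto_le[OF trivial_limit_at_top_linorder] by blast
  moreover have "(\<Sum>i\<in>UNIV. \<Lambda> i) / R = \<Lambda> k / R + (\<Sum>i\<in>UNIV - {k}. \<Lambda> i / R)"
    unfolding sum_divide_distrib by (rule sum.remove) auto
  ultimately have "\<Lambda> k / R \<le> d" by linarith
  then show ?thesis using R by (simp add: field_simps)
qed

lemma subspace_repar_growth_at_most:
  "subspace {v. \<exists>K. eventually (\<lambda>\<tau>. tnorm g (\<psi> \<tau> x) (D\<psi> \<tau> v) \<le> K * exp (c * \<tau>)) at_top}"
proof (rule subspaceI)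
  show "0 \<in> {v. \<exists>K. eventually (\<lambda>\<tau>. tnorm g (\<psi> \<tau> x) (D\<psi> \<tau> v) \<le> K * exp (c * \<tau>)) at_top}"
  proof -
    have "tnorm g (\<psi> \<tau> x) (D\<psi> \<tau> 0) \<le> 0 * exp (c * \<tau>)" for \<tau>
      using tnorm_simps(4)[where g = g, OF g, where c = 0 and v = 0] by (simp add: linear_0[OF repar.tangent_map_linear])
    then show ?thesis by (intro CollectI exI[of _ 0] always_eventually allI)
  qed
next
  fix v w
  assume "v \<in> {v. \<exists>K. eventually (\<lambda>\<tau>. tnorm g (\<psi> \<tau> x) (D\<psi> \<tau> v) \<le> K * exp (c * \<tau>)) at_top}"
    and "w \<in> {v. \<exists>K. eventually (\<lambda>\<tau>. tnorm g (\<psi> \<tau> x) (D\<psi> \<tau> v) \<le> K * exp (c * \<tau>)) at_top}"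
  then obtain K L where "eventually (\<lambda>\<tau>. tnorm g (\<psi> \<tau> x) (D\<psi> \<tau> v) \<le> K * exp (c * \<tau>)) at_top"
    "eventually (\<lambda>\<tau>. tnorm g (\<psi> \<tau> x) (D\<psi> \<tau> w) \<le> L * exp (c * \<tau>)) at_top" by blast
  then have "eventually (\<lambda>\<tau>. tnorm g (\<psi> \<tau> x) (D\<psi> \<tau> (v + w)) \<le> (K + L) * exp (c * \<tau>)) at_top"
  proof eventually_elim
    case (elim \<tau>)
    have "tnorm g (\<psi> \<tau> x) (D\<psi> \<tau> (v + w)) \<le> tnorm g (\<psi> \<tau> x) (D\<psi> \<tau> v) + tnorm g (\<psi> \<tau> x) (D\<psi> \<tau> w)"
      unfolding linear_add[OF repar.tangent_map_linear] by (rule tnorm_simps(3)[OF g])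
    then show ?case using elim by (simp add: distrib_right)
  qed
  then show "v + w \<in> {v. \<exists>K. eventually (\<lambda>\<tau>. tnorm g (\<psi> \<tau> x) (D\<psi> \<tau> v) \<le> K * exp (c * \<tau>)) at_top}"
    by blast
next
  fix s v
  assume "v \<in> {v. \<exists>K. eventually (\<lambda>\<tau>. tnorm g (\<psi> \<tau> x) (D\<psi> \<tau> v) \<le> K * exp (c * \<tau>)) at_top}"
  then obtain K where "eventually (\<lambda>\<tau>. tnorm g (\<psi> \<tau> x) (D\<psi> \<tau> v) \<le> K * exp (c * \<tau>)) at_top" by blast
  then have "eventually (\<lambda>\<tau>. tnorm g (\<psi> \<tau> x) (D\<psi> \<tau> (s *\<^sub>R v)) \<le> (\<bar>s\<bar> * K) * exp (c * \<tau>)) at_top"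
  proof eventually_elim
    case (elim \<tau>)
    then show ?case
      unfolding linear_cmul[OF repar.tangent_map_linear] tnorm_simps(4)[OF g] mult.assoc
      by (intro mult_left_mono) auto
  qed
  then show "s *\<^sub>R v \<in> {v. \<exists>K. eventually (\<lambda>\<tau>. tnorm g (\<psi> \<tau> x) (D\<psi> \<tau> v) \<le> K * exp (c * \<tau>)) at_top}"
    by blast
qed

text \<open>Vectors that decay at a common exponential rate form a subspace, which cannot contain \<open>e j\<close> since its
exponent is \<open>0\<close>.\<close>

lemma flow_direction_not_decaying:
  assumes vol: "((\<lambda>\<tau>. 1 / \<tau> * ln (jacobian A g (\<psi> \<tau>) x)) \<longlongrightarrow> S) at_top"
    and decay: "\<And>u. u \<in> U \<Longrightarrow> u \<noteq> 0 \<Longrightarrow>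
      \<exists>d \<le> c. ((\<lambda>\<tau>. 1 / \<tau> * ln (tnorm g (\<psi> \<tau> x) (D\<psi> \<tau> u))) \<longlongrightarrow> d) at_top"
    and c: "c < 0"
  shows "e j \<notin> span U"
proof
  assume ej: "e j \<in> span U"
  \<comment> \<open>all of \<open>U\<close> decays at least like \<open>exp (- 2 * \<delta> * \<tau>)\<close>, and \<open>e j\<close> no faster than \<open>exp (- \<delta> * \<tau>)\<close>\<close>
  define \<delta> where "\<delta> = - c / 3"
  have \<delta>: "0 < \<delta>" "c = - 3 * \<delta>" unfolding \<delta>_def using c by auto
  let ?V = "{v. \<exists>K. eventually (\<lambda>\<tau>. tnorm g (\<psi> \<tau> x) (D\<psi> \<tau> v) \<le> K * exp (- 2 * \<delta> * \<tau>)) at_top}"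
  have "U \<subseteq> ?V"
  proof
    fix u assume u: "u \<in> U"
    show "u \<in> ?V"
    proof (cases "u = 0")
      case True
      then show ?thesis using subspace_0[OF subspace_repar_growth_at_most] by blast
    next
      case False
      then obtain d where d: "d \<le> c" "((\<lambda>\<tau>. 1 / \<tau> * ln (tnorm g (\<psi> \<tau> x) (D\<psi> \<tau> u))) \<longlongrightarrow> d) at_top"
        using decay[OF u] by blast
      have "d < - 2 * \<delta>" using d(1) \<delta> by linarith
      from order_tendstoD(2)[OF d(2) this] eventually_gt_at_top[of 0]
      have "eventually (\<lambda>\<tau>. tnorm g (\<psi> \<tau> x) (D\<psi> \<tau> u) \<le> 1 * exp (- 2 * \<delta> * \<tau>)) at_top"
      proof eventually_elim
        case (elim \<tau>)
        have p: "0 < tnorm g (\<psi> \<tau> x) (D\<psi> \<tau> u)"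
          by (rule tnorm_simps(1)[OF g repar.tangent_map_nonzero[OF False]])
        have "ln (tnorm g (\<psi> \<tau> x) (D\<psi> \<tau> u)) \<le> - 2 * \<delta> * \<tau>"
          using elim by (simp add: field_simps)
        then have "exp (ln (tnorm g (\<psi> \<tau> x) (D\<psi> \<tau> u))) \<le> exp (- 2 * \<delta> * \<tau>)" by (simp only: exp_le_cancel_iff)
        then show ?case using p by simp
      qed
      then show ?thesis by blast
    qed
  qed
  then have "e j \<in> ?V" using ej span_minimal[OF _ subspace_repar_growth_at_most] by blast
  then obtain K where K: "eventually (\<lambda>\<tau>. tnorm g (\<psi> \<tau> x) (D\<psi> \<tau> (e j)) \<le> K * exp (- 2 * \<delta> * \<tau>)) at_top"
    by blast
  have "- \<delta> < 0" using \<delta> by simp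
  have big: "filterlim (\<lambda>\<tau>. \<delta> * \<tau>) at_top at_top"
    by (rule filterlim_tendsto_pos_mult_at_top[OF tendsto_const \<delta>(1) filterlim_ident])
  from K order_tendstoD(1)[OF repar_exponent_flow_direction[OF vol] \<open>- \<delta> < 0\<close>] eventually_gt_at_top[of 0]
    filterlim_compose[OF exp_at_top big, unfolded filterlim_at_top_dense, rule_format, of K]
  have "eventually (\<lambda>\<tau>. exp (- \<delta> * \<tau>) < exp (- \<delta> * \<tau>)) at_top"
  proof eventually_elim
    case (elim \<tau>)
    have p: "0 < tnorm g (\<psi> \<tau> x) (D\<psi> \<tau> (e j))"
      by (rule tnorm_simps(1)[OF g repar.tangent_map_nonzero[OF e_nonzero]])
    have "- \<delta> * \<tau> \<le> ln (tnorm g (\<psi> \<tau> x) (D\<psi> \<tau> (e j)))" using elim(2,3) by (simp add: field_simps)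
    then have "exp (- \<delta> * \<tau>) \<le> tnorm g (\<psi> \<tau> x) (D\<psi> \<tau> (e j))" using p by (simp add: ln_ge_iff)
    also have "\<dots> \<le> K * exp (- 2 * \<delta> * \<tau>)" by (rule elim(1))
    also have "\<dots> < exp (\<delta> * \<tau>) * exp (- 2 * \<delta> * \<tau>)" using elim(4) by simp
    also have "\<dots> = exp (- \<delta> * \<tau>)" by (simp add: algebra_simps flip: exp_add)
    finally show ?case .
  qed
  then show False by simp
qed

end

section \<open>Comparison of the two lists of exponents\<close>

context reparameterized_orbit
begin

text \<open>A termwise inequality between two sequences of equal sum. The inequality comes from counting: too small an exponent
of \<open>\<psi>\<close> at position \<open>i\<close> would confine \<open>i\<close> independent vectors to the span of \<open>f x\<close> and \<open>i - 1\<close> vectors of the basis for \<open>\<phi>\<close>,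
which is impossible for reasons of dimension or because the flow direction does not decay.\<close>

lemma lyap_exponents_reparameterized:
  assumes reg: "lyap_regular A g \<phi> x" and reg': "lyap_regular A g \<psi> x"
    and idx: "flow_direction_index A g f \<phi> x j" and zero: "lyap_exponent A g \<phi> x j = 0"
    and i: "i \<in> {1..CARD('n)}"
  shows "lyap_exponent A g \<psi> x i * R = lyap_exponent A g \<phi> x i"
proof -
  define n where "n = CARD('n)"
  define \<Lambda> where "\<Lambda> = lyap_exponent A g \<phi> x"
  define M where "M = lyap_exponent A g \<psi> x"
  obtain e where e: "\<And>i. i \<in> {1..n} \<Longrightarrow> e i \<in> lyap_space A g \<phi> x (\<Lambda> i)"
    "inj_on e {1..n}" "independent (e ` {1..n})"
    using lyap_adapted_basis(1)[OF reg] unfolding n_def \<Lambda>_def by blast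
  obtain u where u: "\<And>i. i \<in> {1..n} \<Longrightarrow> u i \<in> lyap_space A g \<psi> x (M i)"
    "inj_on u {1..n}" "independent (u ` {1..n})"
    using lyap_adapted_basis(1)[OF reg'] unfolding n_def M_def by blast
  have j: "j \<in> {1..n}" and ej: "lyap_space A g \<phi> x (\<Lambda> j) = span {f x}"
    using idx unfolding flow_direction_index_def n_def \<Lambda>_def by auto
  have e0: "e i \<noteq> 0" if "i \<in> {1..n}" for i
    using dependent_zero[of "e ` {1..n}"] e(3) that by (metis image_eqI)
  have u0: "u i \<noteq> 0" if "i \<in> {1..n}" for i
    using dependent_zero[of "u ` {1..n}"] u(3) that by (metis image_eqI)
  obtain b where b: "e j = b *\<^sub>R f x" using e(1)[OF j] unfolding ej span_singleton by blast
  obtain k where k: "bij_betw k {1..n} (UNIV :: 'n set)"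
    using ex_bij_betw_nat_finite_1[of "UNIV :: 'n set"] unfolding n_def by auto
  define h where "h = inv_into {1..n} k"
  have h: "bij_betw h UNIV {1..n}" unfolding h_def by (rule bij_betw_inv_into[OF k])
  have hk: "h (k i) = i" if "i \<in> {1..n}" for i
    unfolding h_def by (rule bij_betw_inv_into_left[OF k that])
  have h_in: "h i \<in> {1..n}" for i using bij_betwE[OF h] by blast
  define E where "E = e \<circ> h"
  have rangeE: "range E = e ` {1..n}" unfolding E_def image_comp[symmetric] bij_betw_imp_surj_on[OF h] ..
  have injE: "inj E"
    unfolding E_def using h e(2) by (metis bij_betw_def comp_inj_on)
  have indE: "independent (range E)" unfolding rangeE by (rule e(3))
  have reg_vol: "((\<lambda>t. 1 / t * ln (jacobian A g (\<phi> t) x)) \<longlongrightarrow> (\<Sum>i=1..n. \<Lambda> i)) at_top"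
    using reg unfolding lyap_regular_def tendsto_both_ends_def n_def \<Lambda>_def lyap_adapted_basis(3)[OF reg] by blast
  have reg_vol': "((\<lambda>t. 1 / t * ln (jacobian A g (\<psi> t) x)) \<longlongrightarrow> (\<Sum>i=1..n. M i)) at_top"
    using reg' unfolding lyap_regular_def tendsto_both_ends_def n_def M_def lyap_adapted_basis(3)[OF reg'] by blast
  have sumE: "(\<Sum>i\<in>UNIV. \<Lambda> (h i)) = (\<Sum>i=1..n. \<Lambda> i)" by (rule sum.reindex_bij_betw[OF h])
  interpret adapted_frame A m l \<phi> f \<psi> r T g x R E "\<lambda>i. \<Lambda> (h i)" "k j" b
  proof
    show "det (\<chi> i. E i) \<noteq> 0" by (rule det_independent_rows[OF injE indE])
    show "E (k j) = b *\<^sub>R f x" unfolding E_def o_apply hk[OF j] by (rule b)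
    show "((\<lambda>t. 1 / t * ln (tnorm g (\<phi> t x) (tangent_map A (\<phi> t) x (E i)))) \<longlongrightarrow> \<Lambda> (h i)) at_top" for i
      unfolding E_def o_apply by (rule lyap_space_tendsto[OF e(1)[OF h_in] e0[OF h_in]])
    show "((\<lambda>t. 1 / t * ln (jacobian A g (\<phi> t) x)) \<longlongrightarrow> (\<Sum>i\<in>UNIV. \<Lambda> (h i))) at_top"
      unfolding sumE by (rule reg_vol)
    show "\<Lambda> (h (k j)) = 0" unfolding hk[OF j] using zero \<Lambda>_def by simp
  qed
  have mono: "\<Lambda> p \<le> \<Lambda> q" "M p \<le> M q" if "1 \<le> p" "p \<le> q" "q \<le> n" for p q
    using lyap_adapted_basis(2)[OF reg, of p q] lyap_adapted_basis(2)[OF reg', of p q] that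
    unfolding n_def \<Lambda>_def M_def by auto
  have le: "\<Lambda> i \<le> M i * R" if i: "i \<in> {1..n}" for i
  proof (rule ccontr)
    assume "\<not> \<Lambda> i \<le> M i * R"
    then have lt: "M i * R < \<Lambda> i" by simp
    define Q where "Q = e ` ({1..<i} \<union> {j})"
    have uQ: "u ` {1..i} \<subseteq> span Q"
    proof
      fix v assume "v \<in> u ` {1..i}"
      then obtain p where p: "v = u p" "1 \<le> p" "p \<le> i" by auto
      then have p_in: "p \<in> {1..n}" using i by auto
      have limv: "((\<lambda>\<tau>. 1 / \<tau> * ln (tnorm g (\<psi> \<tau> x) (tangent_map A (\<psi> \<tau>) x v))) \<longlongrightarrow> M p) at_top"
        unfolding p(1) by (rule lyap_space_tendsto[OF u(1)[OF p_in] u0[OF p_in]])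
      obtain a where a: "v = (\<Sum>i\<in>UNIV. a i *\<^sub>R E i)" by (rule frame_expansion[OF injE indE])
      have "a q *\<^sub>R E q \<in> span Q" for q
      proof (cases "h q < i \<or> h q = j")
        case True
        then have "E q \<in> Q" unfolding Q_def E_def o_apply using h_in[of q] by auto
        then show ?thesis by (intro span_scale span_base)
      next
        case False
        then have "q \<noteq> k j" using hk[OF j] by auto
        have "a q = 0"
        proof (rule ccontr)
          assume "a q \<noteq> 0"
          then have "\<Lambda> (h q) \<le> M p * R"
            by (rule repar_exponent_lower_bound[OF a _ \<open>q \<noteq> k j\<close> limv])
          also have "\<dots> \<le> M i * R" using mono(2)[of p i] p i R by simp
          also have "\<dots> < \<Lambda> i" by (rule lt)
          also have "\<dots> \<le> \<Lambda> (h q)" using mono(1)[of i "h q"] False h_in[of q] i by auto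
          finally show False by simp
        qed
        then show ?thesis by (simp add: span_zero)
      qed
      then show "v \<in> span Q" unfolding a by (rule span_sum)
    qed
    have ind_u: "independent (u ` {1..i})" by (rule independent_mono[OF u(3)]) (use i in auto)
    have card_u: "card (u ` {1..i}) = i"
      using card_image[OF inj_on_subset[OF u(2)], of "{1..i}"] i by auto
    have finQ: "finite Q" unfolding Q_def by simp
    show False
    proof (cases "j < i")
      case True
      then have "{1..<i} \<union> {j} = {1..<i}" using j by auto
      then have "card Q \<le> card {1..<i}" unfolding Q_def by (simp only: card_image_le finite_atLeastLessThan)
      moreover have "i \<le> card Q" using independent_span_bound[OF finQ ind_u uQ] card_u by simp
      ultimately show False using i by auto
    next
      case False
      \<comment> \<open>now \<open>Q\<close> has at most \<open>i\<close> elements, so the \<open>i\<close> independent vectors span it and \<open>f x\<close> is a combination of decaying vectors\<close>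
      have "card Q \<le> card ({1..<i} \<union> {j})" unfolding Q_def by (rule card_image_le) simp
      also have "\<dots> \<le> card {1..<i} + card {j}" by (rule card_Un_le)
      finally have "card Q \<le> i" using i by auto
      then have "dim (span Q) \<le> card (u ` {1..i})"
        unfolding card_u dim_span using dim_le_card'[OF finQ] by linarith
      then have "span Q \<subseteq> span (u ` {1..i})" by (rule card_ge_dim_independent[OF uQ ind_u])
      moreover have "E (k j) \<in> span Q"
        unfolding Q_def E_def o_apply hk[OF j] by (intro span_base) simp
      ultimately have "E (k j) \<in> span (u ` {1..i})" by blast
      moreover have "E (k j) \<notin> span (u ` {1..i})"
      proof (rule flow_direction_not_decaying[OF reg_vol', where c = "M i"])
        fix w assume "w \<in> u ` {1..i}"
        then obtain p where p: "w = u p" "1 \<le> p" "p \<le> i" by auto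
        then have p_in: "p \<in> {1..n}" using i by auto
        have "((\<lambda>\<tau>. 1 / \<tau> * ln (tnorm g (\<psi> \<tau> x) (tangent_map A (\<psi> \<tau>) x w))) \<longlongrightarrow> M p) at_top"
          unfolding p(1) by (rule lyap_space_tendsto[OF u(1)[OF p_in] u0[OF p_in]])
        then show "\<exists>d\<le>M i. ((\<lambda>\<tau>. 1 / \<tau> * ln (tnorm g (\<psi> \<tau> x) (tangent_map A (\<psi> \<tau>) x w))) \<longlongrightarrow> d) at_top"
          using mono(2)[of p i] p i by auto
      next
        have "\<Lambda> i \<le> \<Lambda> j" using mono(1)[of i j] False i j by auto
        then have "M i * R < 0" using lt zero \<Lambda>_def by simp
        then show "M i < 0" using R by (simp add: mult_less_0_iff)
      qed
      ultimately show False by blast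
    qed
  qed
  have "(\<Sum>i=1..n. M i * R) = (\<Sum>i=1..n. \<Lambda> i)"
    using repar_volume(1)[OF reg_vol'] unfolding sumE sum_distrib_right .
  then have "\<Lambda> i = M i * R"
    using i unfolding n_def[symmetric] by (intro sum_mono_inv[of \<Lambda> "{1..n}" "\<lambda>i. M i * R"] le) auto
  then show ?thesis unfolding M_def \<Lambda>_def by simp
qed

end

theorem theorem1:
  fixes A :: "('a::{t2_space, second_countable_topology}, 'n::finite) chart set"
    and g :: "'a \<Rightarrow> real ^ 'n \<Rightarrow> real ^ 'n \<Rightarrow> real"
    and f :: "'a \<Rightarrow> real ^ 'n"
    and \<phi> \<psi> :: "real \<Rightarrow> 'a \<Rightarrow> 'a"
    and r :: "'a \<Rightarrow> real"
    and m l :: nat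
  assumes "2 \<le> m" and "1 \<le> l" and "l < m"
    and "Ck_manifold m A"
    and "Ck_riemannian_metric A (m - 1) g"
    and "Ck_vector_field A l f"
    and "Ck_flow A l \<phi>"
    and "generates A f \<phi>"
    and "time_reparameterization A l f \<phi> \<psi> r"
    and "\<forall>x\<in>R_set A g l f \<phi> r. \<forall>j. flow_direction_index A g f \<phi> x j \<longrightarrow>
           (\<forall>i\<in>{1..<j}. lyap_exponent A g \<phi> x i < 0) \<and>
           lyap_exponent A g \<phi> x j = 0 \<and>
           (\<forall>i\<in>{j<..CARD('n)}. 0 < lyap_exponent A g \<phi> x i)"
  shows "\<forall>x\<in>R_set A g l f \<phi> r. \<forall>r_plus.
           lyap_regular A g \<phi> x \<and> lyap_regular A g \<psi> x \<and>
           (orbit_average \<phi> r x \<longlongrightarrow> r_plus) at_top \<and> 0 < r_plus \<longrightarrow>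
           (\<forall>i\<in>{1..CARD('n)}. lyap_exponent A g \<psi> x i * r_plus = lyap_exponent A g \<phi> x i) \<and>
           card {i \<in> {1..CARD('n)}. 0 < lyap_exponent A g \<psi> x i} =
             card {i \<in> {1..CARD('n)}. 0 < lyap_exponent A g \<phi> x i} \<and>
           card {i \<in> {1..CARD('n)}. lyap_exponent A g \<psi> x i = 0} =
             card {i \<in> {1..CARD('n)}. lyap_exponent A g \<phi> x i = 0} \<and>
           card {i \<in> {1..CARD('n)}. lyap_exponent A g \<psi> x i < 0} =
             card {i \<in> {1..CARD('n)}. lyap_exponent A g \<phi> x i < 0}"
proof (intro ballI allI impI)
  fix x r_plus
  assume x_R: "x \<in> R_set A g l f \<phi> r"
    and H: "lyap_regular A g \<phi> x \<and> lyap_regular A g \<psi> x \<and>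
           (orbit_average \<phi> r x \<longlongrightarrow> r_plus) at_top \<and> 0 < r_plus"
  obtain j where idx: "flow_direction_index A g f \<phi> x j" using x_R unfolding R_set_def by blast
  have zero: "lyap_exponent A g \<phi> x j = 0" using assms(10) x_R idx by blast
  have "dim (span {f x}) = 1" using idx unfolding flow_direction_index_def by metis
  then have x: "f x \<noteq> 0" by auto
  note tr = assms(9)[unfolded time_reparameterization_def]
  obtain T where T: "orbit_time_change \<phi> \<psi> T"
    "\<And>x. f x \<noteq> 0 \<Longrightarrow> (T x has_real_derivative inverse (r x)) (at 0)"
    using tr by blast
  have g: "inner_form (g y)" for y
    using assms(5) unfolding Ck_riemannian_metric_def inner_form_def by blast
  interpret reparameterized_orbit A m l \<phi> f \<psi> r T g x r_plus
    by unfold_locales (use assms(2,4,7,8) tr T g x H in blast)+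
  have eq: "lyap_exponent A g \<psi> x i * r_plus = lyap_exponent A g \<phi> x i" if "i \<in> {1..CARD('n)}" for i
    using lyap_exponents_reparameterized[OF _ _ idx zero that] H by blast
  have sgn: "0 < lyap_exponent A g \<psi> x i \<longleftrightarrow> 0 < lyap_exponent A g \<phi> x i"
    "lyap_exponent A g \<psi> x i = 0 \<longleftrightarrow> lyap_exponent A g \<phi> x i = 0"
    "lyap_exponent A g \<psi> x i < 0 \<longleftrightarrow> lyap_exponent A g \<phi> x i < 0" if "i \<in> {1..CARD('n)}" for i
    unfolding eq[OF that, symmetric] using R by (auto simp: zero_less_mult_iff mult_less_0_iff)
  have "{i \<in> {1..CARD('n)}. 0 < lyap_exponent A g \<psi> x i} = {i \<in> {1..CARD('n)}. 0 < lyap_exponent A g \<phi> x i}"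
    "{i \<in> {1..CARD('n)}. lyap_exponent A g \<psi> x i = 0} = {i \<in> {1..CARD('n)}. lyap_exponent A g \<phi> x i = 0}"
    "{i \<in> {1..CARD('n)}. lyap_exponent A g \<psi> x i < 0} = {i \<in> {1..CARD('n)}. lyap_exponent A g \<phi> x i < 0}"
    using sgn by blast+
  then show "(\<forall>i\<in>{1..CARD('n)}. lyap_exponent A g \<psi> x i * r_plus = lyap_exponent A g \<phi> x i) \<and>
           card {i \<in> {1..CARD('n)}. 0 < lyap_exponent A g \<psi> x i} =
             card {i \<in> {1..CARD('n)}. 0 < lyap_exponent A g \<phi> x i} \<and>
           card {i \<in> {1..CARD('n)}. lyap_exponent A g \<psi> x i = 0} =
             card {i \<in> {1..CARD('n)}. lyap_exponent A g \<phi> x i = 0} \<and>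
           card {i \<in> {1..CARD('n)}. lyap_exponent A g \<psi> x i < 0} =
             card {i \<in> {1..CARD('n)}. lyap_exponent A g \<phi> x i < 0}"
    using eq by simp
qed

end
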